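(* Let $d \geq 1$, let $\Phi \in C(\mathbb{R}^d) \cap L^1(\mathbb{R}^d)$ be a real-valued positive-definite function and let $H(\mathbb{R}^d)$ be the reproducing kernel Hilbert space of the translation-invariant kernel $K(x,y) = \Phi(x-y)$ on $\mathbb{R}^d$. If $\mathcal{F}\Phi(\xi) = O(e^{-\alpha \lVert \xi \rVert})$ for some $\alpha > 0$, then every function in $H(\mathbb{R}^d)$ is real analytic and the zero function is the only function in $H(\mathbb{R}^d)$ that vanishes on a non-empty open set.
   Context: A function $\Phi \colon \mathbb{R}^d \to \mathbb{R}$ is positive-definite if the kernel $K(x,y)=\Phi(x-y)$ is symmetric and $\sum_{i,j=1}^n c_i c_j \Phi(y_i-y_j) > 0$ for all $n$, all distinct $y_1,\ldots,y_n \in \mathbb{R}^d$ and all $(c_1,\ldots,c_n) \in \mathbb{R}^n \setminus \{0\}$. The reproducing kernel Hilbert space of $K$ is the unique Hilbert space of functions $f \colon \mathbb{R}^d \to \mathbb{R}$ containing every $K(\cdot,x)$ and satisfying $\langle f, K(\cdot,x)\rangle = f(x)$ for all $f$ and $x$. The Fourier transform is $\mathcal{F}\Phi(\xi) = (2\pi)^{-d/2}\int_{\mathbb{R}^d} \Phi(x) e^{-\mathrm{i}x\cdot\xi}\,dx$ (real and non-negative for such $\Phi$; called the spectral density). It is a known result that $H(\mathbb{R}^d) = \{ f \in C(\mathbb{R}^d) \cap L^2(\mathbb{R}^d) : \int_{\mathbb{R}^d} |\mathcal{F}f(\xi)|^2 / \mathcal{F}\Phi(\xi)\, d\xi < \infty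 \}$. The notation $\mathcal{F}\Phi(\xi)=O(e^{-\alpha\lVert\xi\rVert})$ means that there is $C>0$ with $\mathcal{F}\Phi(\xi) \leq C e^{-\alpha\lVert\xi\rVert}$ for all $\xi \in \mathbb{R}^d$; $\lVert\cdot\rVert$ is the Euclidean norm. *)

theory Defs
  imports "HOL-Analysis.Analysis"
begin

definition positive_definite :: "('a::ab_group_add \<Rightarrow> real) \<Rightarrow> bool" where
  "positive_definite \<Phi> \<longleftrightarrow>
     (\<forall>x y. \<Phi> (x - y) = \<Phi> (y - x)) \<and>
     (\<forall>(n::nat) (y :: nat \<Rightarrow> 'a) (c :: nat \<Rightarrow> real).
        inj_on y {..<n} \<longrightarrow> (\<exists>i<n. c i \<noteq> 0) \<longrightarrow>
        (\<Sum>i<n. \<Sum>j<n. c i * c j * \<Phi> (y i - y j)) > 0)"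

text \<open>A Hilbert space of real-valued functions, given by its carrier \<open>H\<close> and its inner
  product \<open>ip\<close>; the values of \<open>ip\<close> outside \<open>H\<close> are irrelevant.\<close>

locale hilbert_function_space =
  fixes H :: "('a \<Rightarrow> real) set"
    and ip :: "('a \<Rightarrow> real) \<Rightarrow> ('a \<Rightarrow> real) \<Rightarrow> real"
  assumes zero_mem: "(\<lambda>x. 0) \<in> H"
    and add_mem: "\<lbrakk>f \<in> H; g \<in> H\<rbrakk> \<Longrightarrow> (\<lambda>x. f x + g x) \<in> H"
    and scale_mem: "f \<in> H \<Longrightarrow> (\<lambda>x. c * f x) \<in> H"
    and ip_commute: "\<lbrakk>f \<in> H; g \<in> H\<rbrakk> \<Longrightarrow> ip f g = ip g f"
    and ip_add_left: "\<lbrakk>f \<in> H; g \<in> H; h \<in> H\<rbrakk> \<Longrightarrow> ip (\<lambda>x. f x + g x) h = ip f h + ip g h"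
    and ip_scale_left: "\<lbrakk>f \<in> H; g \<in> H\<rbrakk> \<Longrightarrow> ip (\<lambda>x. c * f x) g = c * ip f g"
    and ip_nonneg: "f \<in> H \<Longrightarrow> 0 \<le> ip f f"
    and ip_eq_zero: "\<lbrakk>f \<in> H; ip f f = 0\<rbrakk> \<Longrightarrow> f = (\<lambda>x. 0)"
    and complete:
      "\<lbrakk>\<And>n. X n \<in> H;
        \<And>e. 0 < e \<Longrightarrow> \<exists>N. \<forall>m\<ge>N. \<forall>n\<ge>N. sqrt (ip (\<lambda>x. X m x - X n x) (\<lambda>x. X m x - X n x)) < e\<rbrakk>
       \<Longrightarrow> \<exists>f\<in>H. (\<lambda>n::nat. sqrt (ip (\<lambda>x. X n x - f x) (\<lambda>x. X n x - f x))) \<longlonglongrightarrow> 0"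

text \<open>A reproducing kernel Hilbert space is determined by its kernel, so a result about the
  reproducing kernel Hilbert space of \<open>K\<close> is stated for every \<open>(H, ip)\<close> satisfying the
  following predicate.\<close>

locale rkhs = hilbert_function_space H ip
  for K :: "'a \<Rightarrow> 'a \<Rightarrow> real"
    and H :: "('a \<Rightarrow> real) set"
    and ip :: "('a \<Rightarrow> real) \<Rightarrow> ('a \<Rightarrow> real) \<Rightarrow> real" +
  assumes kernel_mem: "(\<lambda>y. K y x) \<in> H"
    and reproducing: "f \<in> H \<Longrightarrow> ip f (\<lambda>y. K y x) = f x"

definition fourier :: "(real ^ 'n \<Rightarrow> real) \<Rightarrow> real ^ 'n \<Rightarrow> complex" where
  "fourier \<Phi> \<xi> =
     complex_of_real ((2 * pi) powr (- real CARD('n) / 2)) *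
     (LINT x|lborel. complex_of_real (\<Phi> x) * exp (- (\<i> * complex_of_real (x \<bullet> \<xi>))))"

text \<open>The sum ranges over all multi-indices \<open>m\<close>; \<open>has_sum\<close> is unconditional, hence absolute,
  convergence, so no ordering of the multi-indices is involved.\<close>

definition real_analytic :: "(real ^ 'n \<Rightarrow> real) \<Rightarrow> bool" where
  "real_analytic f \<longleftrightarrow>
     (\<forall>x0. \<exists>r>0. \<exists>a :: ('n \<Rightarrow> nat) \<Rightarrow> real. \<forall>x\<in>ball x0 r.
        ((\<lambda>m. a m * (\<Prod>i\<in>UNIV. (x $ i - x0 $ i) ^ m i)) has_sum f x) UNIV)"

text \<open>The transform of an integrable continuous positive-definite function is real and
  non-negative, so the bound is a one-sided bound on its real part.\<close>

definition spectral_decay :: "(real ^ 'n \<Rightarrow> real) \<Rightarrow> real \<Rightarrow> bool" where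
  "spectral_decay \<Phi> \<alpha> \<longleftrightarrow>
     (\<exists>C>0. \<forall>\<xi>. Re (fourier \<Phi> \<xi>) \<le> C * exp (- \<alpha> * norm \<xi>))"

end

theory Submission
  imports Defs "HOL-Probability.Probability" "HOL-Complex_Analysis.Cauchy_Integral_Formula"
begin

text \<open>
  Positive definiteness and the decay of the transform give a finite measure \<open>M\<close> with
  \<open>\<Phi> x = \<integral> cos (x \<bullet> \<xi>) dM\<close> and finite exponential moments. Hence the quadratic form of the kernel is
  the squared \<open>L\<^sup>2 M\<close>-norm of a trigonometric polynomial, and by Cauchy--Schwarz and Riesz every
  \<open>h\<close> that is square integrable with respect to \<open>M\<close> yields an element of \<open>H\<close>, of norm at most that
  of \<open>h\<close>, namely \<open>x \<mapsto> \<integral> Re (exp (- \<i> x \<bullet> \<xi>) h \<xi>) dM\<close>. The kernel \<open>K (\<cdot>, x)\<close> comes from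
  \<open>h \<xi> = exp (\<i> x \<bullet> \<xi>)\<close>, whose Taylor expansion around \<open>x0\<close> therefore converges in \<open>H\<close>; pairing it
  with \<open>f\<close> expands \<open>f\<close> in a power series around \<open>x0\<close>. The radius does not depend on \<open>x0\<close>, so the
  interior of the zero set of \<open>f\<close> contains, with each point, a ball of fixed radius.
\<close>

section \<open>Riesz representation in a reproducing kernel Hilbert space\<close>

text \<open>\<open>H\<close> is known only through its axioms, so a function can be shown to lie in
  \<open>H\<close> only through completeness: it does once it induces a bounded functional on the
  span of the kernel sections. This is why a Riesz theorem is needed at all. The decay hypothesis
  bounds the transform from above only. Nonnegativity has to be known before the transform is
  integrable, and integrability before the inversion formula makes it the density of
  \<open>M\<close>. Nonnegativity is a statement about double integrals, while positive definiteness
  speaks of finite sums. Random points connect the two, and since Lebesgue measure on the whole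
  space is not a probability measure, the points follow Gaussian laws of growing width. The sums
  over multi-indices are unordered, so every estimate is made for an arbitrary finite set of
  multi-indices and factors over the coordinates. For that reason the exponential weight uses the
  sum of the \<open>\<bar>\<xi> $ k\<bar>\<close> and not the Euclidean norm; this costs the factor
  \<open>CARD('n)\<close> in the rate \<open>s\<close>. Against such a weight the Taylor terms of
  order \<open>m\<close> cost the power of \<open>1 / s\<close> given by the total degree of
  \<open>m\<close>, and so \<open>s\<close> also governs the radius of convergence.\<close>

context hilbert_function_space
begin

lemma minus_mem: "f \<in> H \<Longrightarrow> g \<in> H \<Longrightarrow> (\<lambda>x. f x - g x) \<in> H"
  using add_mem[of f "\<lambda>x. (-1) * g x"] scale_mem[of g "-1"] by simp

lemma sum_mem: "(\<And>i. i \<in> I \<Longrightarrow> f i \<in> H) \<Longrightarrow> (\<lambda>x. \<Sum>i\<in>I. f i x) \<in> H"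
  by (induction I rule: infinite_finite_induct) (auto intro: zero_mem add_mem)

lemma ip_zero_left: "f \<in> H \<Longrightarrow> ip (\<lambda>x. 0) f = 0"
  using ip_scale_left[of "\<lambda>x. 0" f 0] zero_mem by simp

lemma ip_sum_left:
  "(\<And>i. i \<in> I \<Longrightarrow> f i \<in> H) \<Longrightarrow> g \<in> H \<Longrightarrow> ip (\<lambda>x. \<Sum>i\<in>I. f i x) g = (\<Sum>i\<in>I. ip (f i) g)"
  by (induction I rule: infinite_finite_induct) (auto simp: ip_zero_left ip_add_left sum_mem)

lemma ip_diff_left:
  "f \<in> H \<Longrightarrow> g \<in> H \<Longrightarrow> h \<in> H \<Longrightarrow> ip (\<lambda>x. f x - g x) h = ip f h - ip g h"
  using ip_add_left[of f "\<lambda>x. (-1) * g x" h] ip_scale_left[of g h "-1"] scale_mem[of g "-1"] by simp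

lemma ip_add_right:
  "f \<in> H \<Longrightarrow> g \<in> H \<Longrightarrow> h \<in> H \<Longrightarrow> ip h (\<lambda>x. f x + g x) = ip h f + ip h g"
  by (simp add: ip_commute[of h] ip_add_left add_mem)

lemma ip_diff_right:
  "f \<in> H \<Longrightarrow> g \<in> H \<Longrightarrow> h \<in> H \<Longrightarrow> ip h (\<lambda>x. f x - g x) = ip h f - ip h g"
  by (simp add: ip_commute[of h] ip_diff_left minus_mem)

lemma ip_scale_right: "f \<in> H \<Longrightarrow> h \<in> H \<Longrightarrow> ip h (\<lambda>x. c * f x) = c * ip h f"
  by (simp add: ip_commute[of h] ip_scale_left scale_mem)

lemma ip_sum_right:
  "(\<And>i. i \<in> I \<Longrightarrow> f i \<in> H) \<Longrightarrow> g \<in> H \<Longrightarrow> ip g (\<lambda>x. \<Sum>i\<in>I. f i x) = (\<Sum>i\<in>I. ip g (f i))"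
  by (simp add: ip_commute[of g] ip_sum_left sum_mem)

definition nrm :: "('a \<Rightarrow> real) \<Rightarrow> real" where
  "nrm f = sqrt (ip f f)"

lemma nrm_nonneg: "f \<in> H \<Longrightarrow> 0 \<le> nrm f"
  by (simp add: nrm_def ip_nonneg)

lemma nrm_square: "f \<in> H \<Longrightarrow> (nrm f)\<^sup>2 = ip f f"
  by (simp add: nrm_def ip_nonneg)

lemma ip_Cauchy_Schwarz:
  assumes f: "f \<in> H" and g: "g \<in> H"
  shows "\<bar>ip f g\<bar> \<le> nrm f * nrm g"
proof (cases "ip g g = 0")
  case True
  then have "g = (\<lambda>x. 0)" using ip_eq_zero g by blast
  then show ?thesis using ip_zero_left[OF f] ip_commute[OF f g] f g by (simp add: nrm_nonneg)
next
  case False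
  define t where "t = ip f g / ip g g"
  have pos: "ip g g > 0" using False ip_nonneg[OF g] by simp
  have m: "(\<lambda>x. t * g x) \<in> H" using g by (rule scale_mem)
  have "0 \<le> ip (\<lambda>x. f x - t * g x) (\<lambda>x. f x - t * g x)"
    by (intro ip_nonneg minus_mem f m)
  also have "\<dots> = ip f f - 2 * t * ip f g + t\<^sup>2 * ip g g"
    using f g m by (simp add: ip_diff_left ip_diff_right ip_scale_left ip_scale_right minus_mem
        ip_commute[of g f] power2_eq_square algebra_simps)
  also have "\<dots> = ip f f - (ip f g)\<^sup>2 / ip g g"
    using pos by (simp add: t_def power2_eq_square field_simps)
  finally have "(ip f g)\<^sup>2 \<le> ip f f * ip g g" using pos by (simp add: field_simps)
  then have "sqrt ((ip f g)\<^sup>2) \<le> sqrt (ip f f * ip g g)" by (rule real_sqrt_le_mono)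
  then show ?thesis by (simp add: nrm_def real_sqrt_mult)
qed

lemma nrm_triangle_diff:
  assumes f: "f \<in> H" and g: "g \<in> H"
  shows "\<bar>nrm f - nrm g\<bar> \<le> nrm (\<lambda>x. f x - g x)"
proof -
  have "(nrm f - nrm g)\<^sup>2 = ip f f + ip g g - 2 * (nrm f * nrm g)"
    using f g by (simp add: power2_diff nrm_square)
  also have "\<dots> \<le> ip f f + ip g g - 2 * ip f g"
    using ip_Cauchy_Schwarz[OF f g] by simp
  also have "\<dots> = (nrm (\<lambda>x. f x - g x))\<^sup>2"
    using f g by (simp add: nrm_square minus_mem ip_diff_left ip_diff_right ip_commute[of g f])
  finally show ?thesis
    by (metis abs_le_square_iff abs_of_nonneg f g minus_mem nrm_nonneg)
qed

text \<open>The functional is given by its graph \<open>W\<close>. The representing element is the limit of a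
  minimising sequence of \<open>nrm p ^ 2 - 2 l\<close> over \<open>(p, l) \<in> W\<close>.\<close>

lemma riesz_representation:
  assumes W0: "((\<lambda>x. 0), 0) \<in> W"
    and Wadd: "\<And>p l p' l'. (p, l) \<in> W \<Longrightarrow> (p', l') \<in> W \<Longrightarrow> ((\<lambda>x. p x + p' x), l + l') \<in> W"
    and Wscale: "\<And>p l c. (p, l) \<in> W \<Longrightarrow> ((\<lambda>x. c * p x), c * l) \<in> W"
    and WH: "\<And>p l. (p, l) \<in> W \<Longrightarrow> p \<in> H"
    and Wbound: "\<And>p l. (p, l) \<in> W \<Longrightarrow> \<bar>l\<bar> \<le> B * nrm p"
    and B: "0 \<le> B"
  shows "\<exists>q\<in>H. nrm q \<le> B \<and> (\<forall>(p, l)\<in>W. ip p q = l)"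
proof -
  define V where "V = (\<lambda>(p, l). ip p p - 2 * l) ` W"
  define J where "J = Inf V"
  \<comment> \<open>Completing the square: \<open>(nrm p)\<^sup>2 - 2 * B * nrm p\<close> is
    \<open>(nrm p - B)\<^sup>2 - B\<^sup>2\<close>.\<close>
  have lower: "- B\<^sup>2 \<le> v" if "v \<in> V" for v
  proof -
    from that obtain p l where pl: "(p, l) \<in> W" and v: "v = ip p p - 2 * l" by (auto simp: V_def)
    have "l \<le> B * nrm p" using Wbound[OF pl] by simp
    moreover have "0 \<le> (nrm p - B)\<^sup>2" by simp
    ultimately show ?thesis using nrm_square[OF WH[OF pl]]
      unfolding v power2_diff by (simp add: mult.commute)
  qed
  have bdd: "bdd_below V" using lower by (rule bdd_belowI)
  have ne: "V \<noteq> {}" using W0 by (auto simp: V_def)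
  have Jle: "J \<le> ip p p - 2 * l" if "(p, l) \<in> W" for p l
    unfolding J_def by (rule cInf_lower[OF _ bdd]) (use that in \<open>force simp: V_def\<close>)
  have "\<exists>w\<in>W. ip (fst w) (fst w) - 2 * snd w < J + inverse (real (Suc n))" for n
  proof -
    have "Inf V < J + inverse (real (Suc n))" by (simp add: J_def)
    then obtain v where "v \<in> V" "v < J + inverse (real (Suc n))"
      using cInf_lessD[OF ne] by blast
    then show ?thesis by (force simp: V_def)
  qed
  then obtain w where wW: "\<And>n. w n \<in> W"
    and wlt: "\<And>n. ip (fst (w n)) (fst (w n)) - 2 * snd (w n) < J + inverse (real (Suc n))"
    by metis
  define X L where "X n = fst (w n)" and "L n = snd (w n)" for n
  have XW: "(X n, L n) \<in> W" and Xlt: "ip (X n) (X n) - 2 * L n < J + inverse (real (Suc n))" for n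
    using wW wlt by (auto simp: X_def L_def)
  note XH = WH[OF XW]
  have dist: "ip (\<lambda>x. X m x - X n x) (\<lambda>x. X m x - X n x)
      \<le> 2 * inverse (real (Suc m)) + 2 * inverse (real (Suc n))" for m n
  proof -
    \<comment> \<open>The midpoint of two near-minimisers competes for the infimum as well; by the
      parallelogram law the two must then be close.\<close>
    define h :: real where "h = 1/2"
    have "((\<lambda>x. h * (X m x + X n x)), h * (L m + L n)) \<in> W"
      by (intro Wscale Wadd XW)
    from Jle[OF this]
    have "J \<le> h * h * (ip (X m) (X m) + 2 * ip (X m) (X n) + ip (X n) (X n)) - 2 * (h * (L m + L n))"
      using XH by (simp add: ip_scale_left ip_scale_right scale_mem ip_add_left ip_add_right add_mem
          ip_commute[of "X n" "X m"] algebra_simps)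
    then have "J \<le> (1/4) * (ip (X m) (X m) + 2 * ip (X m) (X n) + ip (X n) (X n)) - (L m + L n)"
      by (simp add: h_def field_simps)
    moreover have "ip (\<lambda>x. X m x - X n x) (\<lambda>x. X m x - X n x)
        = ip (X m) (X m) - 2 * ip (X m) (X n) + ip (X n) (X n)"
      using XH by (simp add: minus_mem ip_diff_left ip_diff_right ip_commute[of "X n" "X m"])
    ultimately show ?thesis using Xlt[of m] Xlt[of n] by argo
  qed
  have "\<exists>q\<in>H. (\<lambda>n::nat. sqrt (ip (\<lambda>x. X n x - q x) (\<lambda>x. X n x - q x))) \<longlonglongrightarrow> 0"
  proof (rule complete)
    fix e :: real assume e: "0 < e"
    obtain N where N: "inverse (real (Suc N)) < e\<^sup>2 / 4"
      using reals_Archimedean[of "e\<^sup>2/4"] e by auto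
    have "sqrt (ip (\<lambda>x. X m x - X n x) (\<lambda>x. X m x - X n x)) < e" if "m \<ge> N" "n \<ge> N" for m n
    proof -
      have "inverse (real (Suc m)) \<le> inverse (real (Suc N))" "inverse (real (Suc n)) \<le> inverse (real (Suc N))"
        using that by (auto intro!: le_imp_inverse_le)
      with dist[of m n] N have "ip (\<lambda>x. X m x - X n x) (\<lambda>x. X m x - X n x) < e\<^sup>2" by argo
      then show ?thesis using e real_less_lsqrt by simp
    qed
    then show "\<exists>N. \<forall>m\<ge>N. \<forall>n\<ge>N. sqrt (ip (\<lambda>x. X m x - X n x) (\<lambda>x. X m x - X n x)) < e" by blast
  qed (rule XH)
  then obtain q where q: "q \<in> H" and lim: "(\<lambda>n. nrm (\<lambda>x. X n x - q x)) \<longlonglongrightarrow> 0"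
    by (auto simp: nrm_def)
  have lim_ip: "(\<lambda>n. ip (X n) p) \<longlonglongrightarrow> ip q p" if p: "p \<in> H" for p
  proof (rule LIM_zero_cancel, rule Lim_null_comparison)
    show "(\<lambda>n. nrm (\<lambda>x. X n x - q x) * nrm p) \<longlonglongrightarrow> 0"
      using tendsto_mult_right[OF lim] by simp
    show "\<forall>\<^sub>F n in sequentially. norm (ip (X n) p - ip q p) \<le> nrm (\<lambda>x. X n x - q x) * nrm p"
      using ip_Cauchy_Schwarz[OF minus_mem[OF XH q] p] by (simp add: ip_diff_left XH q p)
  qed
  have lim_nrm: "(\<lambda>n. nrm (X n)) \<longlonglongrightarrow> nrm q"
    by (rule LIM_zero_cancel, rule Lim_null_comparison[OF _ lim])
      (simp add: nrm_triangle_diff XH q)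
  have rep: "ip p q = l" if pl: "(p, l) \<in> W" for p l
  proof -
    note pH = WH[OF pl]
    \<comment> \<open>First variation: moving the near-minimiser \<open>X n\<close> in the direction
      \<open>p\<close> cannot bring the value below \<open>J\<close>. In the limit the slack
      \<open>inverse (real (Suc n))\<close> disappears, and a quadratic in \<open>s\<close> that is
      nonnegative for all \<open>s\<close> and has no constant term has zero linear
      coefficient.\<close>
    have var: "0 \<le> inverse (real (Suc n)) + 2 * s * (ip (X n) p - l) + s\<^sup>2 * ip p p" for n s
    proof -
      have "((\<lambda>x. X n x + s * p x), L n + s * l) \<in> W" by (intro Wadd Wscale XW pl)
      from Jle[OF this]
      have "J \<le> ip (X n) (X n) + 2 * s * ip (X n) p + s\<^sup>2 * ip p p - 2 * (L n + s * l)"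
        using XH pH by (simp add: ip_add_left ip_add_right add_mem scale_mem ip_scale_left
          ip_scale_right ip_commute[of p "X n"] power2_eq_square algebra_simps)
      with Xlt[of n] show ?thesis by (simp add: algebra_simps)
    qed
    have lim_var: "0 \<le> 0 + 2 * s * (ip q p - l) + s\<^sup>2 * ip p p" for s
    proof (rule LIMSEQ_le_const)
      show "(\<lambda>n. inverse (real (Suc n)) + 2 * s * (ip (X n) p - l) + s\<^sup>2 * ip p p)
          \<longlonglongrightarrow> 0 + 2 * s * (ip q p - l) + s\<^sup>2 * ip p p"
        by (intro tendsto_intros lim_ip[OF pH] LIMSEQ_inverse_real_of_nat)
    qed (use var in blast)
    have "ip q p = l"
    proof (rule ccontr)
      assume "ip q p \<noteq> l"
      define y where "y = ip q p - l"
      have y: "y \<noteq> 0" using \<open>ip q p \<noteq> l\<close> by (simp add: y_def)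
      have "0 \<le> 2 * s * y + s\<^sup>2 * ip p p" for s using lim_var[of s] by (simp add: y_def)
      \<comment> \<open>The summand 1 keeps the denominator positive when \<open>ip p p = 0\<close>
        and makes the quadratic term at most half as large as the linear one.\<close>
      from this[of "- y / (1 + ip p p)"]
      have "0 \<le> - 2 * y\<^sup>2 / (1 + ip p p) + y\<^sup>2 / (1 + ip p p) * (ip p p / (1 + ip p p))"
        by (simp add: power2_eq_square)
      also have "\<dots> \<le> - 2 * y\<^sup>2 / (1 + ip p p) + y\<^sup>2 / (1 + ip p p) * 1"
        using ip_nonneg[OF pH] by (intro add_left_mono mult_left_mono) auto
      also have "\<dots> = - (y\<^sup>2 / (1 + ip p p))" by simp
      also have "\<dots> < 0" using y ip_nonneg[OF pH] by (simp add: add_pos_nonneg)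
      finally show False by simp
    qed
    then show ?thesis by (simp add: ip_commute q pH)
  qed
  \<comment> \<open>The representation applies to the minimising sequence itself:
    \<open>ip (X n) q = L n\<close>, which is at most \<open>B * nrm (X n)\<close>.\<close>
  have "nrm q * nrm q \<le> B * nrm q"
  proof (rule LIMSEQ_le)
    show "(\<lambda>n. ip (X n) q) \<longlonglongrightarrow> nrm q * nrm q"
      using lim_ip[OF q] nrm_square[OF q] by (simp add: power2_eq_square)
    show "(\<lambda>n. B * nrm (X n)) \<longlonglongrightarrow> B * nrm q" by (intro tendsto_intros lim_nrm)
    show "\<exists>N. \<forall>n\<ge>N. ip (X n) q \<le> B * nrm (X n)" using rep[OF XW] Wbound[OF XW] by (auto simp: abs_le_iff)
  qed
  then have "nrm q \<le> B" using nrm_nonneg[OF q] B by (cases "nrm q = 0") auto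
  with q rep show ?thesis by auto
qed

end

section \<open>Membership in the reproducing kernel Hilbert space via bounded functionals\<close>

context rkhs
begin

abbreviation combination :: "'a set \<Rightarrow> ('a \<Rightarrow> real) \<Rightarrow> 'a \<Rightarrow> real" where
  "combination X c \<equiv> (\<lambda>y. \<Sum>x\<in>X. c x * K y x)"

lemma combination_mem: "combination X c \<in> H"
  by (intro sum_mem scale_mem kernel_mem)

lemma ip_combination:
  assumes "f \<in> H"
  shows "ip (combination X c) f = (\<Sum>x\<in>X. c x * f x)"
proof -
  have "ip (combination X c) f = (\<Sum>x\<in>X. ip (\<lambda>y. c x * K y x) f)"
    using assms by (intro ip_sum_left scale_mem kernel_mem)
  also have "\<dots> = (\<Sum>x\<in>X. c x * f x)"
    using assms by (intro sum.cong refl) (simp add: ip_scale_left kernel_mem ip_commute reproducing)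
  finally show ?thesis .
qed

lemma combination_nrm: "(nrm (combination X c))\<^sup>2 = (\<Sum>x\<in>X. \<Sum>y\<in>X. c x * c y * K x y)"
  by (simp add: nrm_square combination_mem ip_combination sum_distrib_left mult.assoc)

lemma combination_eq_extend:
  assumes "finite Y" "X \<subseteq> Y"
  shows "(\<Sum>x\<in>X. c x * g x) = (\<Sum>x\<in>Y. (if x \<in> X then c x else 0) * (g x :: real))"
  using assms by (simp add: if_distrib[of "\<lambda>z. z * _"] sum.inter_restrict[symmetric] Int_absorb1 cong: if_cong)

text \<open>By \<open>combination_nrm\<close> the double sum is a squared norm, so the hypothesis
  says that evaluating \<open>k\<close> at the nodes is a functional bounded by \<open>B\<close> on
  the kernel combinations. Its Riesz representer, paired with the kernel section at
  \<open>x\<close>, takes the value \<open>k x\<close>; hence it is \<open>k\<close>.\<close>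

lemma memI_bounded_functional:
  assumes B: "0 \<le> B"
    and bound: "\<And>X c. finite X \<Longrightarrow>
      (\<Sum>x\<in>X. c x * k x)\<^sup>2 \<le> B\<^sup>2 * (\<Sum>x\<in>X. \<Sum>y\<in>X. c x * c y * K x y)"
  shows "k \<in> H" "nrm k \<le> B"
proof -
  \<comment> \<open>A relation and not a function of \<open>combination X c\<close>: different
    \<open>X\<close> and \<open>c\<close> may give the same element of \<open>H\<close>.
    Single-valuedness is implied by the bound.\<close>
  define W where "W = {(combination X c, \<Sum>x\<in>X. c x * k x) | X c. finite X}"
  have "\<exists>q\<in>H. nrm q \<le> B \<and> (\<forall>(p, l)\<in>W. ip p q = l)"
  proof (rule riesz_representation)
    show "((\<lambda>x. 0), 0) \<in> W" unfolding W_def by (force intro: exI[of _ "{}"])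
  next
    fix p l p' l' assume "(p, l) \<in> W" "(p', l') \<in> W"
    then obtain X c X' c' where fin: "finite X" "finite X'"
      and eqs: "p = combination X c" "l = (\<Sum>x\<in>X. c x * k x)"
        "p' = combination X' c'" "l' = (\<Sum>x\<in>X'. c' x * k x)" by (auto simp: W_def)
    define e where "e x = (if x \<in> X then c x else 0) + (if x \<in> X' then c' x else 0)" for x
    have *: "(\<Sum>x\<in>X. c x * g x) + (\<Sum>x\<in>X'. c' x * g x) = (\<Sum>x\<in>X \<union> X'. e x * g x)" for g
      using combination_eq_extend[of "X \<union> X'" X c g] combination_eq_extend[of "X \<union> X'" X' c' g] fin
      by (simp add: e_def distrib_right sum.distrib)
    show "((\<lambda>x. p x + p' x), l + l') \<in> W"
      unfolding eqs * W_def using fin by blast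
  next
    fix p l a assume "(p, l) \<in> W"
    then obtain X c where fin: "finite X"
      and eqs: "p = combination X c" "l = (\<Sum>x\<in>X. c x * k x)" by (auto simp: W_def)
    have *: "a * (\<Sum>x\<in>X. c x * g x) = (\<Sum>x\<in>X. (a * c x) * g x)" for g
      by (simp add: sum_distrib_left mult.assoc)
    show "((\<lambda>x. a * p x), a * l) \<in> W"
      unfolding eqs * W_def using fin by (intro CollectI exI[of _ X] exI[of _ "\<lambda>x. a * c x"]) simp
  next
    fix p l assume pl: "(p, l) \<in> W"
    then obtain X c where fin: "finite X"
      and eqs: "p = combination X c" "l = (\<Sum>x\<in>X. c x * k x)" by (auto simp: W_def)
    show pH: "p \<in> H" unfolding eqs by (rule combination_mem)
    have "l\<^sup>2 \<le> (B * nrm p)\<^sup>2"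
      using bound[OF fin, of c] by (simp add: eqs combination_nrm power_mult_distrib)
    then show "\<bar>l\<bar> \<le> B * nrm p"
      using B nrm_nonneg[OF pH] by (simp add: abs_le_square_iff[symmetric])
  qed fact
  then obtain q where q: "q \<in> H" "nrm q \<le> B" "\<forall>(p, l)\<in>W. ip p q = l" by blast
  have "q x = k x" for x
  proof -
    have "((\<lambda>y. K y x), k x) \<in> W"
      unfolding W_def by (auto intro!: exI[of _ "{x}"] exI[of _ "\<lambda>_. 1"])
    with q(3) have "ip (\<lambda>y. K y x) q = k x"
      by (auto dest!: bspec)
    then show ?thesis
      using reproducing[OF q(1), of x] ip_commute[OF q(1) kernel_mem] by simp
  qed
  then have "q = k" by auto
  with q show "k \<in> H" "nrm k \<le> B" by auto
qed

end

section \<open>Gaussian integrals\<close>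

lemma integral_lborel_affine:
  fixes f :: "'a::euclidean_space \<Rightarrow> 'b::{banach, second_countable_topology}"
  assumes c: "c \<noteq> 0" and [measurable]: "f \<in> borel_measurable borel"
  shows "integral\<^sup>L lborel f = \<bar>c\<bar> ^ DIM('a) *\<^sub>R (LINT x|lborel. f (t + c *\<^sub>R x))"
  by (subst lborel_affine[OF c, of t])
    (simp add: integral_density integral_distr)

lemma integrable_lborel_affine:
  fixes f :: "'a::euclidean_space \<Rightarrow> 'b::{banach, second_countable_topology}"
  assumes c: "c \<noteq> 0" and f: "integrable lborel f"
  shows "integrable lborel (\<lambda>x. f (t + c *\<^sub>R x))"
proof -
  have [measurable]: "f \<in> borel_measurable borel" using f by auto
  have "integrable (density (distr lborel borel (\<lambda>x. t + c *\<^sub>R x)) (\<lambda>_. \<bar>c\<bar> ^ DIM('a))) f"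
    using f by (subst lborel_affine[OF c, of t, symmetric])
  then have "integrable lborel (\<lambda>x. \<bar>c\<bar> ^ DIM('a) *\<^sub>R f (t + c *\<^sub>R x))"
    by (simp add: integrable_density integrable_distr_eq)
  then show ?thesis using c
    integrable_scaleR_right[of "inverse (\<bar>c\<bar> ^ DIM('a))" lborel "\<lambda>x. \<bar>c\<bar> ^ DIM('a) *\<^sub>R f (t + c *\<^sub>R x)"]
    by simp
qed

lemma
  fixes f :: "'a::euclidean_space \<Rightarrow> real \<Rightarrow> 'b::{real_normed_field, banach, second_countable_topology}"
  assumes f: "\<And>b. b \<in> Basis \<Longrightarrow> integrable lborel (f b)"
  shows integrable_lborel_prod_Basis: "integrable lborel (\<lambda>x. \<Prod>b\<in>Basis. f b (x \<bullet> b))"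
    and integral_lborel_prod_Basis:
      "(LINT x|lborel. (\<Prod>b\<in>Basis. f b (x \<bullet> b))) = (\<Prod>b\<in>Basis. integral\<^sup>L lborel (f b))"
proof -
  interpret product_sigma_finite "\<lambda>b::'a. lborel :: real measure"
    by standard
  have [measurable]: "f b \<in> borel_measurable borel" if "b \<in> Basis" for b
    using f[OF that] by auto
  have coord: "(\<Sum>b\<in>Basis. g b *\<^sub>R b) \<bullet> b = g b" if "b \<in> Basis" for g and b :: 'a
    using that by (simp add: inner_sum_left inner_Basis if_distrib cong: if_cong)
  have eq: "(\<Prod>b\<in>Basis. f b ((\<Sum>b\<in>Basis. g b *\<^sub>R b) \<bullet> b)) = (\<Prod>b\<in>Basis. f b (g b))" for g
    by (intro prod.cong refl) (simp add: coord)
  have m: "(\<lambda>x. \<Prod>b\<in>Basis. f b (x \<bullet> b)) \<in> borel_measurable borel"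
    by measurable
  have t: "(\<lambda>g. \<Sum>b\<in>Basis. g b *\<^sub>R b) \<in> (\<Pi>\<^sub>M b\<in>(Basis :: 'a set). lborel) \<rightarrow>\<^sub>M borel"
    by measurable
  have "integrable (\<Pi>\<^sub>M b\<in>(Basis :: 'a set). lborel) (\<lambda>g. \<Prod>b\<in>Basis. f b (g b))"
    by (intro product_integrable_prod f) auto
  then show "integrable lborel (\<lambda>x. \<Prod>b\<in>Basis. f b (x \<bullet> b))"
    by (subst lborel_eq) (simp add: integrable_distr_eq[OF t m] eq)
  have "(LINT x|lborel. (\<Prod>b\<in>Basis. f b (x \<bullet> b)))
      = (LINT g|(\<Pi>\<^sub>M b\<in>(Basis :: 'a set). lborel). (\<Prod>b\<in>Basis. f b (g b)))"
    by (subst lborel_eq) (simp add: integral_distr[OF t m] eq)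
  also have "\<dots> = (\<Prod>b\<in>Basis. integral\<^sup>L lborel (f b))"
    by (intro product_integral_prod f) auto
  finally show "(LINT x|lborel. (\<Prod>b\<in>Basis. f b (x \<bullet> b))) = (\<Prod>b\<in>Basis. integral\<^sup>L lborel (f b))" .
qed

definition std_gaussian :: "'a::euclidean_space \<Rightarrow> real" where
  "std_gaussian x = (\<Prod>b\<in>Basis. std_normal_density (x \<bullet> b))"

lemma std_gaussian_eq:
  "std_gaussian (x :: 'a::euclidean_space) = (1 / sqrt (2 * pi)) ^ DIM('a) * exp (- (norm x)\<^sup>2 / 2)"
proof -
  have "(norm x)\<^sup>2 = (\<Sum>b\<in>Basis. (x \<bullet> b)\<^sup>2)"
    by (subst power2_norm_eq_inner, subst euclidean_inner) (simp add: power2_eq_square)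
  then show ?thesis
    by (simp add: std_gaussian_def std_normal_density_def prod.distrib exp_sum[symmetric]
        sum_negf sum_divide_distrib power_one_over prod_dividef)
qed

lemma continuous_on_std_gaussian[continuous_intros]: "continuous_on A std_gaussian"
  unfolding std_gaussian_eq[abs_def] by (intro continuous_intros) auto

lemma measurable_std_gaussian[measurable]: "std_gaussian \<in> borel_measurable borel"
  by (intro borel_measurable_continuous_onI continuous_intros)

lemma std_gaussian_pos: "0 < std_gaussian x"
  by (simp add: std_gaussian_eq)

lemma std_gaussian_nonneg[simp]: "0 \<le> std_gaussian x"
  using std_gaussian_pos[of x] by simp

lemma std_gaussian_le: "std_gaussian (x :: 'a::euclidean_space) \<le> std_gaussian (0 :: 'a)"
  by (simp add: std_gaussian_eq mult_left_le)

lemma integrable_std_gaussian: "integrable lborel std_gaussian"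
  unfolding std_gaussian_def[abs_def] by (intro integrable_lborel_prod_Basis) simp

lemma integral_std_gaussian: "integral\<^sup>L lborel std_gaussian = 1"
  unfolding std_gaussian_def[abs_def] by (subst integral_lborel_prod_Basis) simp_all

text \<open>The cosine of a sum does not factor over the coordinates but \<open>cis\<close> does, so
  the computation is complex and the real part is taken at the end. Each factor is the
  characteristic function of the standard normal law.\<close>

lemma integral_std_gaussian_cos:
  fixes u :: "'a::euclidean_space"
  shows "(LINT x|lborel. std_gaussian x * cos (u \<bullet> x)) = exp (- (norm u)\<^sup>2 / 2)"
proof -
  let ?f = "\<lambda>b t. complex_of_real (std_normal_density t) * cis ((u \<bullet> b) * t)"
  have int: "integrable lborel (?f b)" for b
  proof (rule Bochner_Integration.integrable_bound[OF integrable_normal_density[of 1 0]])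
    show "?f b \<in> borel_measurable lborel" unfolding cis_conv_exp by measurable
  qed (auto simp: norm_mult)
  have one: "integral\<^sup>L lborel (?f b) = complex_of_real (exp (- (u \<bullet> b)\<^sup>2 / 2))" for b
  proof -
    have "char std_normal_distribution (u \<bullet> b) = integral\<^sup>L lborel (?f b)"
      unfolding char_def by (subst integral_density) (auto simp: scaleR_conv_of_real cis_conv_exp)
    then show ?thesis by (simp add: char_std_normal_distribution)
  qed
  have prod: "(\<Prod>b\<in>Basis. ?f b (x \<bullet> b)) = complex_of_real (std_gaussian x) * cis (u \<bullet> x)" for x
  proof -
    have "u \<bullet> x = (\<Sum>b\<in>Basis. (u \<bullet> b) * (x \<bullet> b))" by (rule euclidean_inner)
    then show ?thesis
      by (simp add: prod.distrib std_gaussian_def cis_conv_exp exp_sum[symmetric] sum_distrib_left)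
  qed
  have i: "integrable lborel (\<lambda>x. complex_of_real (std_gaussian x) * cis (u \<bullet> x))"
    using integrable_lborel_prod_Basis[of ?f, OF int] by (simp only: prod)
  have "(LINT x|lborel. complex_of_real (std_gaussian x) * cis (u \<bullet> x))
      = (\<Prod>b\<in>Basis. complex_of_real (exp (- (u \<bullet> b)\<^sup>2 / 2)))"
    using integral_lborel_prod_Basis[of ?f, OF int] by (simp only: prod one)
  also have "\<dots> = complex_of_real (exp (- (norm u)\<^sup>2 / 2))"
  proof -
    have "(norm u)\<^sup>2 = (\<Sum>b\<in>Basis. (u \<bullet> b)\<^sup>2)"
      by (subst power2_norm_eq_inner, subst euclidean_inner) (simp add: power2_eq_square)
    then show ?thesis
      by (simp add: of_real_prod[symmetric] exp_sum[symmetric] sum_negf sum_divide_distrib del: of_real_prod)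
  qed
  finally have "Re (LINT x|lborel. complex_of_real (std_gaussian x) * cis (u \<bullet> x)) = exp (- (norm u)\<^sup>2 / 2)"
    by simp
  then show ?thesis by (subst (asm) integral_Re[OF i, symmetric]) simp
qed

text \<open>Every coordinate is bounded by the norm, so with the rate \<open>a / DIM('a)\<close> in
  each of them the product of one-dimensional exponentials is a majorant.\<close>

lemma integrable_exp_norm:
  fixes a :: real
  assumes "0 < a"
  shows "integrable lborel (\<lambda>x::'a::euclidean_space. exp (- a * norm x))"
proof -
  define b where "b = a / DIM('a)"
  have b: "b > 0" using assms by (simp add: b_def)
  have 1: "integrable lborel (\<lambda>t::real. exp (- b * \<bar>t\<bar>))"
  proof -
    \<comment> \<open>\<open>g\<close> lives on the open half line, so the sum of \<open>g\<close>
      and its reflection misses the value at 0; the comparison holds almost everywhere.\<close>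
    define g where "g t = indicator {0<..} t * exp (- (t * b))" for t :: real
    have g: "integrable lborel g"
      using integrable_I0i_exp_mscale[OF b] by (simp add: g_def[abs_def] set_integrable_def)
    have "integrable lborel (\<lambda>t. g t + g (0 + (-1) *\<^sub>R t))"
      by (intro Bochner_Integration.integrable_add g integrable_lborel_affine) auto
    then show ?thesis
    proof (rule Bochner_Integration.integrable_bound)
      show "AE t in lborel. norm (exp (- b * \<bar>t\<bar>)) \<le> norm (g t + g (0 + (-1) *\<^sub>R t))"
        using AE_lborel_singleton[of "0::real"]
        by eventually_elim (auto simp: g_def indicator_def mult.commute)
    qed simp
  qed
  have int: "integrable lborel (\<lambda>x::'a. \<Prod>i\<in>Basis. exp (- b * \<bar>x \<bullet> i\<bar>))"
    by (rule integrable_lborel_prod_Basis) (rule 1)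
  show ?thesis
  proof (rule Bochner_Integration.integrable_bound[OF int])
    show "AE x::'a in lborel. norm (exp (- a * norm x)) \<le> norm (\<Prod>i\<in>Basis. exp (- b * \<bar>x \<bullet> i\<bar>))"
    proof (rule AE_I2)
      fix x :: 'a
      have "(\<Sum>i\<in>Basis. b * \<bar>x \<bullet> i\<bar>) \<le> (\<Sum>i\<in>(Basis :: 'a set). b * norm x)"
        using b by (intro sum_mono mult_left_mono Basis_le_norm) auto
      also have "\<dots> = a * norm x" by (simp add: b_def)
      finally show "norm (exp (- a * norm x)) \<le> norm (\<Prod>i\<in>Basis. exp (- b * \<bar>x \<bullet> i\<bar>))"
        by (simp add: exp_sum[symmetric] sum_negf)
    qed
  qed simp
qed

section \<open>Positive semidefinite kernels averaged over independent samples\<close>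

text \<open>For an i.i.d. sample of size \<open>n\<close> from \<open>M\<close> the expectation of the quadratic form is at most
  \<open>n B + n (n - 1) I\<close>, where \<open>I\<close> is the integral in question; let \<open>n\<close> tend to infinity.\<close>

lemma (in prob_space) positive_semidefinite_integral_nonneg:
  fixes Q :: "'a \<Rightarrow> 'a \<Rightarrow> real"
  assumes Q[measurable]: "(\<lambda>(x, y). Q x y) \<in> borel_measurable (M \<Otimes>\<^sub>M M)"
    and bound: "\<And>x y. \<bar>Q x y\<bar> \<le> B"
    and psd: "\<And>n (x :: nat \<Rightarrow> 'a). 0 \<le> (\<Sum>i<n. \<Sum>j<n. Q (x i) (x j))"
  shows "0 \<le> (LINT z|(M \<Otimes>\<^sub>M M). Q (fst z) (snd z))"
proof -
  define I where "I = (LINT z|(M \<Otimes>\<^sub>M M). Q (fst z) (snd z))"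
  have [measurable]: "(\<lambda>z. Q (fst z) (snd z)) \<in> borel_measurable (M \<Otimes>\<^sub>M M)"
    using Q by (simp add: case_prod_beta')
  have key: "0 \<le> real n * B + real n * (real n - 1) * I" if n: "n > 0" for n :: nat
  proof -
    define P where "P = (\<Pi>\<^sub>M i\<in>{..<n}. M)"
    interpret PM: product_prob_space "\<lambda>_::nat. M" "{..<n}" by standard
    interpret P: prob_space P unfolding P_def by (intro prob_space_PiM prob_space_axioms)
    have comp[measurable]: "(\<lambda>\<omega>. \<omega> i) \<in> P \<rightarrow>\<^sub>M M" if "i < n" for i
      unfolding P_def using that by (intro measurable_component_singleton) simp
    have distr1: "distr P M (\<lambda>\<omega>. \<omega> i) = M" if "i < n" for i
      unfolding P_def using that by (intro PM.PiM_component) simp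
    \<comment> \<open>The tuple of all coordinates is the identity on \<open>P\<close>, so the joint
      law is the product of the marginals, which is independence.\<close>
    have "P.indep_vars (\<lambda>_. M) (\<lambda>i \<omega>. \<omega> i) {..<n}"
    proof (subst P.indep_vars_iff_distr_eq_PiM')
      show "{..<n} \<noteq> {}" using n by auto
      show "P.random_variable M (\<lambda>\<omega>. \<omega> i)" if "i \<in> {..<n}" for i using that by simp
      have "distr P (Pi\<^sub>M {..<n} (\<lambda>_. M)) (\<lambda>\<omega>. \<lambda>i\<in>{..<n}. \<omega> i) = distr P P (\<lambda>\<omega>. \<omega>)"
        by (rule distr_cong) (auto simp: P_def space_PiM PiE_def extensional_restrict)
      also have "\<dots> = P" by simp
      also have "P = Pi\<^sub>M {..<n} (\<lambda>i. distr P M (\<lambda>\<omega>. \<omega> i))"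
        unfolding P_def by (rule PiM_cong) (auto simp: distr1[unfolded P_def])
      finally show "distr P (Pi\<^sub>M {..<n} (\<lambda>_. M)) (\<lambda>\<omega>. \<lambda>i\<in>{..<n}. \<omega> i)
          = Pi\<^sub>M {..<n} (\<lambda>i. distr P M (\<lambda>\<omega>. \<omega> i))" .
    qed
    note indep = this
    have pair: "distr P (M \<Otimes>\<^sub>M M) (\<lambda>\<omega>. (\<omega> i, \<omega> j)) = M \<Otimes>\<^sub>M M"
      if ij: "i < n" "j < n" "i \<noteq> j" for i j
    proof -
      have "P.indep_var M ((\<lambda>f. f i) \<circ> (\<lambda>\<omega>. \<lambda>i\<in>{i}. \<omega> i)) M ((\<lambda>f. f j) \<circ> (\<lambda>\<omega>. \<lambda>i\<in>{j}. \<omega> i))"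
        using ij by (intro P.indep_var_compose[OF P.indep_var_restrict[OF indep]]) auto
      then have "P.indep_var M (\<lambda>\<omega>. \<omega> i) M (\<lambda>\<omega>. \<omega> j)" by (simp add: comp_def)
      then show ?thesis using ij by (simp add: P.indep_var_distribution_eq distr1)
    qed
    have int: "integrable P (\<lambda>\<omega>. Q (\<omega> i) (\<omega> j))" if "i < n" "j < n" for i j
    proof (rule P.integrable_const_bound[where B=B])
      show "(\<lambda>\<omega>. Q (\<omega> i) (\<omega> j)) \<in> borel_measurable P"
        using measurable_compose[OF measurable_Pair[OF comp[OF that(1)] comp[OF that(2)]] Q] by simp
    qed (simp add: bound)
    have off: "(LINT \<omega>|P. Q (\<omega> i) (\<omega> j)) = I" if "i < n" "j < n" "i \<noteq> j" for i j
      unfolding I_def by (subst pair[OF that, symmetric], subst integral_distr) (use that in simp_all)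
    have diag: "(LINT \<omega>|P. Q (\<omega> i) (\<omega> i)) \<le> B" if "i < n" for i
      using P.integral_le_const[OF int[OF that that]] bound by (simp add: abs_le_iff)
    have "0 \<le> (LINT \<omega>|P. (\<Sum>i<n. \<Sum>j<n. Q (\<omega> i) (\<omega> j)))"
      using psd by (intro integral_nonneg_AE) simp
    also have "\<dots> = (\<Sum>i<n. \<Sum>j<n. LINT \<omega>|P. Q (\<omega> i) (\<omega> j))"
      by (subst Bochner_Integration.integral_sum) (auto intro!: Bochner_Integration.integrable_sum int sum.cong
        Bochner_Integration.integral_sum)
    also have "\<dots> \<le> (\<Sum>i<n. \<Sum>j<n. if i = j then B else I)"
      by (intro sum_mono) (auto simp: off diag)
    also have "\<dots> = (\<Sum>i<n. B + (real n - 1) * I)"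
    proof (rule sum.cong[OF refl])
      fix i assume "i \<in> {..<n}"
      then have "{..<n} = insert i ({..<n} - {i})" by auto
      then have "(\<Sum>j<n. if i = j then B else I) = B + (\<Sum>j\<in>{..<n} - {i}. I)"
        using \<open>i \<in> {..<n}\<close> by (subst sum.remove[of _ i]) (auto intro!: sum.cong)
      then show "(\<Sum>j<n. if i = j then B else I) = B + (real n - 1) * I"
        using \<open>i \<in> {..<n}\<close> n by (simp add: of_nat_diff)
    qed
    finally show ?thesis by (simp add: algebra_simps)
  qed
  have "- B \<le> real n * I" for n
  proof -
    \<comment> \<open>At \<open>Suc n\<close> the factor \<open>n - 1\<close> becomes
      \<open>n\<close>, and the common positive factor can be cancelled. A lower bound on all
      multiples of \<open>I\<close> then excludes \<open>I < 0\<close>.\<close>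
    have "0 \<le> real (Suc n) * (B + real n * I)" using key[of "Suc n"] by (simp add: algebra_simps)
    then have "0 \<le> B + real n * I" by (subst (asm) zero_le_mult_iff) auto
    then show ?thesis by simp
  qed
  then have "0 \<le> I"
    by (metis (no_types, opaque_lifting) ex_less_of_nat_mult mult_minus_right neg_less_iff_less not_less
        neg_0_less_iff_less minus_less_iff)
  then show ?thesis by (simp add: I_def)
qed

section \<open>The spectral measure of a positive-definite function\<close>

definition cosine_transform :: "('a::euclidean_space \<Rightarrow> real) \<Rightarrow> 'a \<Rightarrow> real" where
  "cosine_transform \<Phi> \<xi> = (LINT x|lborel. \<Phi> x * cos (x \<bullet> \<xi>))"

text \<open>The density of the difference of two independent standard Gaussian vectors. It appears
  when a function of \<open>x - y\<close> is averaged over both.\<close>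

definition gaussian_autocorrelation :: "'a::euclidean_space \<Rightarrow> real" where
  "gaussian_autocorrelation u = (LINT x|lborel. std_gaussian x * std_gaussian (x - u))"

lemma measurable_gaussian_autocorrelation[measurable]:
  "gaussian_autocorrelation \<in> borel_measurable (borel :: 'a::euclidean_space measure)"
  unfolding gaussian_autocorrelation_def[abs_def] by measurable

lemma integrable_gaussian_autocorrelation:
  "integrable lborel (\<lambda>x::'a::euclidean_space. std_gaussian x * std_gaussian (x - u))"
  by (rule Bochner_Integration.integrable_bound[OF integrable_mult_left[OF integrable_std_gaussian, of "std_gaussian (0::'a)"]])
    (auto intro!: AE_I2 mult_left_mono std_gaussian_le)

lemma gaussian_autocorrelation_nonneg: "0 \<le> gaussian_autocorrelation u"
  unfolding gaussian_autocorrelation_def by (intro integral_nonneg_AE) auto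

lemma gaussian_autocorrelation_le:
  "gaussian_autocorrelation (u::'a::euclidean_space) \<le> std_gaussian (0::'a)"
proof -
  have "gaussian_autocorrelation u \<le> (LINT x::'a|lborel. std_gaussian x * std_gaussian (0::'a))"
    unfolding gaussian_autocorrelation_def
    by (intro integral_mono integrable_gaussian_autocorrelation integrable_mult_left integrable_std_gaussian
        mult_left_mono std_gaussian_le) simp
  then show ?thesis by (simp add: integral_std_gaussian)
qed

lemma gaussian_autocorrelation_tendsto:
  fixes u :: "nat \<Rightarrow> 'a::euclidean_space"
  assumes "u \<longlonglongrightarrow> 0"
  shows "(\<lambda>n. gaussian_autocorrelation (u n)) \<longlonglongrightarrow> gaussian_autocorrelation (0 :: 'a)"
  unfolding gaussian_autocorrelation_def
proof (rule integral_dominated_convergence[where w="\<lambda>x::'a. std_gaussian x * std_gaussian (0::'a)"])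
  show "integrable lborel (\<lambda>x::'a. std_gaussian x * std_gaussian (0::'a))"
    by (intro integrable_mult_left integrable_std_gaussian)
  show "AE x in lborel. (\<lambda>n. std_gaussian x * std_gaussian (x - u n)) \<longlonglongrightarrow> std_gaussian x * std_gaussian (x - 0)"
    by (intro AE_I2 tendsto_intros continuous_on_tendsto_compose[OF continuous_on_std_gaussian[of UNIV]] assms) auto
  show "AE x in lborel. norm (std_gaussian x * std_gaussian (x - u n)) \<le> std_gaussian x * std_gaussian (0::'a)" for n
    by (auto intro!: AE_I2 mult_left_mono std_gaussian_le)
qed measurable

lemma gaussian_autocorrelation_0_pos: "0 < gaussian_autocorrelation (0 :: 'a::euclidean_space)"
proof -
  have "gaussian_autocorrelation (0 :: 'a) \<noteq> 0"
  proof
    assume "gaussian_autocorrelation (0 :: 'a) = 0"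
    then have "AE x::'a in lborel. std_gaussian x * std_gaussian (x - 0) = 0"
      unfolding gaussian_autocorrelation_def
      using integrable_gaussian_autocorrelation[of "0::'a"] by (subst (asm) integral_nonneg_eq_0_iff_AE) auto
    then have "AE x::'a in lborel. False"
      by eventually_elim (metis std_gaussian_pos mult_eq_0_iff less_irrefl)
    then show False by (simp add: eventually_False ae_filter_eq_bot_iff)
  qed
  then show ?thesis using gaussian_autocorrelation_nonneg[of "0::'a"] by simp
qed

lemma borel_measurable_cosine_transform[measurable]:
  fixes \<Phi> :: "'a::euclidean_space \<Rightarrow> real"
  assumes [measurable]: "\<Phi> \<in> borel_measurable borel"
  shows "cosine_transform \<Phi> \<in> borel_measurable borel"
  unfolding cosine_transform_def[abs_def] by measurable

lemma integrable_mult_cos: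
  fixes \<Phi> :: "'a \<Rightarrow> real"
  assumes "integrable M \<Phi>" "g \<in> borel_measurable M"
  shows "integrable M (\<lambda>x. \<Phi> x * cos (g x))"
  by (rule Bochner_Integration.integrable_bound[OF assms(1)])
    (use assms in \<open>auto simp: abs_mult intro!: AE_I2 mult_left_le\<close>)

text \<open>Multiplying by a cosine keeps the kernel positive semidefinite, so the average of
  \<open>\<Phi> (x - y) * cos ((x - y) \<bullet> \<xi>)\<close> over two independent Gaussian
  vectors of width \<open>t\<close> is nonnegative. As a single integral it carries the
  autocorrelation evaluated at \<open>v / t\<close>. When \<open>t\<close> grows this tends to a
  positive constant, leaving a positive multiple of the cosine transform.\<close>

lemma cosine_transform_nonneg:
  fixes \<Phi> :: "'a::euclidean_space \<Rightarrow> real"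
  assumes int: "integrable lborel \<Phi>"
    and bound: "\<And>x. \<bar>\<Phi> x\<bar> \<le> B"
    and psd: "\<And>n (x :: nat \<Rightarrow> 'a) c. 0 \<le> (\<Sum>i<n. \<Sum>j<n. c i * c j * \<Phi> (x i - x j))"
  shows "0 \<le> cosine_transform \<Phi> \<xi>"
proof -
  have [measurable]: "\<Phi> \<in> borel_measurable borel" using int by auto
  let ?w = "gaussian_autocorrelation :: 'a \<Rightarrow> real"
  let ?g = "std_gaussian :: 'a \<Rightarrow> real"
  define M where "M = density lborel (\<lambda>x. ennreal (?g x))"
  have sets_M[measurable_cong]: "sets M = sets borel" by (simp add: M_def)
  interpret M: prob_space M
    by (rule prob_spaceI)
      (simp add: M_def emeasure_density nn_integral_eq_integral integrable_std_gaussian integral_std_gaussian)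
  interpret MM: pair_prob_space M M ..
  have int_M: "integral\<^sup>L M f = (LINT x|lborel. ?g x * f x)"
    if "f \<in> borel_measurable borel" for f :: "'a \<Rightarrow> real"
    unfolding M_def using that by (subst integral_density) auto
  have smoothed: "0 \<le> (LINT v|lborel. \<Phi> v * cos (v \<bullet> \<xi>) * ?w ((1 / t) *\<^sub>R v))" if t: "t > 0" for t :: real
  proof -
    define q where "q u = \<Phi> (t *\<^sub>R u) * cos ((t *\<^sub>R u) \<bullet> \<xi>)" for u
    have [measurable]: "q \<in> borel_measurable borel" unfolding q_def[abs_def] by measurable
    have q_bound: "\<bar>q u\<bar> \<le> B" for u
    proof -
      have "\<bar>q u\<bar> \<le> \<bar>\<Phi> (t *\<^sub>R u)\<bar>" unfolding q_def by (simp add: abs_mult mult_left_le)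
      then show ?thesis using bound by (rule order_trans)
    qed
    have q_int: "integrable lborel q"
      unfolding q_def[abs_def]
      using integrable_lborel_affine[OF _ integrable_mult_cos[OF int, of "\<lambda>v. v \<bullet> \<xi>"], of t 0] t by simp
    have q_psd: "0 \<le> (\<Sum>i<n. \<Sum>j<n. q (x i - x j))" for n and x :: "nat \<Rightarrow> 'a"
    proof -
      \<comment> \<open>The addition formula splits the cosine of a difference into two products;
        each is absorbed into the coefficients of the quadratic form of
        \<open>\<Phi>\<close>.\<close>
      let ?a = "\<lambda>i. t *\<^sub>R x i"
      have "(\<Sum>i<n. \<Sum>j<n. q (x i - x j)) =
          (\<Sum>i<n. \<Sum>j<n. cos (?a i \<bullet> \<xi>) * cos (?a j \<bullet> \<xi>) * \<Phi> (?a i - ?a j))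
          + (\<Sum>i<n. \<Sum>j<n. sin (?a i \<bullet> \<xi>) * sin (?a j \<bullet> \<xi>) * \<Phi> (?a i - ?a j))"
        unfolding q_def scaleR_diff_right inner_diff_left cos_diff
        by (simp add: sum.distrib[symmetric] algebra_simps)
      also have "\<dots> \<ge> 0" by (intro add_nonneg_nonneg psd)
      finally show ?thesis .
    qed
    have int_pair: "integrable (M \<Otimes>\<^sub>M M) (\<lambda>(x, y). q (x - y))"
      by (rule MM.integrable_const_bound[where B=B]) (auto simp: q_bound)
    have "0 \<le> (LINT z|(M \<Otimes>\<^sub>M M). q (fst z - snd z))"
      by (rule M.positive_semidefinite_integral_nonneg[where B=B and Q="\<lambda>x y. q (x - y)"])
        (auto simp: q_bound q_psd)
    also have "\<dots> = (LINT x|M. LINT y|M. q (x - y))"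
      using MM.integral_fst'[OF int_pair] by (simp add: case_prod_beta')
    also have "\<dots> = (LINT x|lborel. ?g x * (LINT y|lborel. ?g y * q (x - y)))"
      by (simp add: int_M)
    also have "\<dots> = (LINT x|lborel. (LINT u|lborel. ?g x * ?g (x - u) * q u))"
    proof (rule Bochner_Integration.integral_cong[OF refl])
      fix x :: 'a
      have "(LINT y|lborel. ?g y * q (x - y)) = (LINT u|lborel. ?g (x - u) * q u)"
        by (subst integral_lborel_affine[of "-1" _ x]) (auto simp: algebra_simps)
      then show "?g x * (LINT y|lborel. ?g y * q (x - y)) = (LINT u|lborel. ?g x * ?g (x - u) * q u)"
        by (simp add: mult.assoc)
    qed
    also have "\<dots> = (LINT u|lborel. (LINT x|lborel. ?g x * ?g (x - u) * q u))"
    proof (rule lborel_pair.Fubini_integral[symmetric])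
      \<comment> \<open>Replacing the second Gaussian by its maximum decouples the
        variables.\<close>
      have "integrable (lborel \<Otimes>\<^sub>M lborel) (\<lambda>(x, u). ?g x * ?g 0 * q u)"
      proof (rule lborel_pair.Fubini_integrable)
        show "integrable lborel (\<lambda>x. LINT u|lborel. norm (case (x, u) of (x, u) \<Rightarrow> ?g x * ?g 0 * q u))"
          by (simp add: abs_mult integrable_std_gaussian mult.assoc)
      qed (auto intro!: AE_I2 integrable_mult_right q_int)
      then show "integrable (lborel \<Otimes>\<^sub>M lborel) (\<lambda>(x, u). ?g x * ?g (x - u) * q u)"
        by (rule Bochner_Integration.integrable_bound)
          (auto simp: abs_mult intro!: AE_I2 mult_left_mono mult_right_mono std_gaussian_le)
    qed
    also have "\<dots> = (LINT u|lborel. q u * ?w u)"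
      unfolding gaussian_autocorrelation_def by (simp add: mult.commute)
    finally have "0 \<le> (LINT u|lborel. q u * ?w u)" .
    moreover have "(LINT v|lborel. \<Phi> v * cos (v \<bullet> \<xi>) * ?w ((1 / t) *\<^sub>R v)) = t ^ DIM('a) * (LINT u|lborel. q u * ?w u)"
      using t by (subst integral_lborel_affine[of t _ 0]) (auto simp: q_def)
    ultimately show ?thesis using t by simp
  qed
  have "(\<lambda>n. LINT v|lborel. \<Phi> v * cos (v \<bullet> \<xi>) * ?w ((1 / real (Suc n)) *\<^sub>R v))
      \<longlonglongrightarrow> (LINT v|lborel. \<Phi> v * cos (v \<bullet> \<xi>) * ?w 0)"
  proof (rule integral_dominated_convergence[where w="\<lambda>v. norm (\<Phi> v) * ?g 0"])
    show "integrable lborel (\<lambda>v. norm (\<Phi> v) * ?g 0)" using int by simp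
    have "(\<lambda>n. (1 / real (Suc n)) *\<^sub>R v) \<longlonglongrightarrow> 0 *\<^sub>R v" for v :: 'a
      using LIMSEQ_inverse_real_of_nat by (intro tendsto_intros) (simp add: inverse_eq_divide)
    then show "AE v in lborel. (\<lambda>n. \<Phi> v * cos (v \<bullet> \<xi>) * ?w ((1 / real (Suc n)) *\<^sub>R v))
        \<longlonglongrightarrow> \<Phi> v * cos (v \<bullet> \<xi>) * ?w 0"
      by (intro AE_I2 tendsto_mult_left gaussian_autocorrelation_tendsto) simp
    show "AE v in lborel. norm (\<Phi> v * cos (v \<bullet> \<xi>) * ?w ((1 / real (Suc n)) *\<^sub>R v)) \<le> norm (\<Phi> v) * ?g 0" for n
    proof (rule AE_I2)
      fix v :: 'a
      have "\<bar>cos (v \<bullet> \<xi>)\<bar> * ?w ((1 / real (Suc n)) *\<^sub>R v) \<le> 1 * ?g 0"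
        by (intro mult_mono gaussian_autocorrelation_le gaussian_autocorrelation_nonneg) auto
      then show "norm (\<Phi> v * cos (v \<bullet> \<xi>) * ?w ((1 / real (Suc n)) *\<^sub>R v)) \<le> norm (\<Phi> v) * ?g 0"
        by (simp add: abs_mult mult.assoc mult_left_mono gaussian_autocorrelation_nonneg)
    qed
  qed measurable
  then have "0 \<le> (LINT v|lborel. \<Phi> v * cos (v \<bullet> \<xi>) * ?w 0)"
    by (rule LIMSEQ_le_const) (use smoothed in auto)
  also have "\<dots> = cosine_transform \<Phi> \<xi> * ?w 0" by (simp add: cosine_transform_def)
  finally show ?thesis using gaussian_autocorrelation_0_pos[where 'a='a] by (simp add: zero_le_mult_iff)
qed

text \<open>A Gaussian factor of width \<open>1 / e\<close> makes the double integral absolutely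
  convergent. After the exchange of integrals the inner one is the transform of a Gaussian, again a
  Gaussian, so the regularized integral is an average of \<open>\<Phi>\<close> around
  \<open>x\<close> at scale \<open>e\<close>. Both sides converge as \<open>e\<close> tends to 0:
  the left by integrability of the transform, the right by continuity and boundedness of
  \<open>\<Phi>\<close>.\<close>

lemma cosine_inversion:
  fixes \<Phi> :: "'a::euclidean_space \<Rightarrow> real"
  assumes cont: "continuous_on UNIV \<Phi>"
    and int: "integrable lborel \<Phi>"
    and bound: "\<And>x. \<bar>\<Phi> x\<bar> \<le> B"
    and even: "\<And>x. \<Phi> (- x) = \<Phi> x"
    and int_transform: "integrable lborel (cosine_transform \<Phi>)"
  shows "(LINT \<xi>|lborel. cosine_transform \<Phi> \<xi> * cos (x \<bullet> \<xi>)) = (2 * pi) ^ DIM('a) * \<Phi> x"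
proof -
  have [measurable]: "\<Phi> \<in> borel_measurable borel" using int by auto
  let ?g = "std_gaussian :: 'a \<Rightarrow> real"
  let ?c = "cosine_transform \<Phi>"
  \<comment> \<open>The normalising constant of the Gaussian. One factor \<open>k\<close> comes from
    the Gaussian cutoff at 0 and one from its transform, so \<open>1 / k\<^sup>2\<close> is the
    constant of the formula.\<close>
  define k where "k = ?g 0"
  have k: "0 < k" by (simp add: k_def std_gaussian_pos)
  have g_eq: "?g x = k * exp (- (norm x)\<^sup>2 / 2)" for x by (simp add: k_def std_gaussian_eq)
  have k2: "1 / k\<^sup>2 = (2 * pi) ^ DIM('a)"
  proof -
    have "k\<^sup>2 = ((1 / sqrt (2 * pi))\<^sup>2) ^ DIM('a)"
      by (simp add: k_def std_gaussian_eq power_mult[symmetric] mult.commute[of _ 2] del: power_divide)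
    also have "(1 / sqrt (2 * pi))\<^sup>2 = 1 / (2 * pi)" by (simp add: power_divide)
    finally show ?thesis by (simp add: power_one_over)
  qed
  have odd_zero: "(LINT y|lborel. \<Phi> y * sin (y \<bullet> \<xi>)) = 0" for \<xi>
  proof -
    have "(LINT y|lborel. \<Phi> y * sin (y \<bullet> \<xi>)) = (LINT y|lborel. \<Phi> (- y) * sin ((- y) \<bullet> \<xi>))"
      by (subst integral_lborel_affine[of "-1" _ 0]) auto
    then show ?thesis by (simp add: even)
  qed
  \<comment> \<open>The addition formula produces an additional sine term, which vanishes because
    \<open>\<Phi>\<close> is even.\<close>
  have shift: "?c \<xi> * cos (x \<bullet> \<xi>) = (LINT y|lborel. \<Phi> y * cos ((x - y) \<bullet> \<xi>))" for \<xi>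
  proof -
    have s: "integrable lborel (\<lambda>y. \<Phi> y * sin (y \<bullet> \<xi>))"
      by (rule Bochner_Integration.integrable_bound[OF int])
        (auto simp: abs_mult intro!: AE_I2 mult_left_le)
    have "(LINT y|lborel. \<Phi> y * cos ((x - y) \<bullet> \<xi>))
        = (LINT y|lborel. (\<Phi> y * cos (y \<bullet> \<xi>)) * cos (x \<bullet> \<xi>) + (\<Phi> y * sin (y \<bullet> \<xi>)) * sin (x \<bullet> \<xi>))"
      by (simp add: inner_diff_left cos_diff algebra_simps)
    also have "\<dots> = ?c \<xi> * cos (x \<bullet> \<xi>) + (LINT y|lborel. \<Phi> y * sin (y \<bullet> \<xi>)) * sin (x \<bullet> \<xi>)"
      unfolding cosine_transform_def using s integrable_mult_cos[OF int, of "\<lambda>y. y \<bullet> \<xi>"]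
      by (subst Bochner_Integration.integral_add) auto
    finally show ?thesis by (simp add: odd_zero)
  qed
  have regularized: "k * (LINT \<xi>|lborel. ?c \<xi> * cos (x \<bullet> \<xi>) * ?g (e *\<^sub>R \<xi>)) = (LINT z|lborel. \<Phi> (x - e *\<^sub>R z) * ?g z)"
    if e: "e > 0" for e :: real
  proof -
    have ge_int: "integrable lborel (\<lambda>\<xi>. ?g (e *\<^sub>R \<xi>))"
      using integrable_lborel_affine[OF _ integrable_std_gaussian, of e 0] e by simp
    have ft: "k * (LINT \<xi>|lborel. cos (u \<bullet> \<xi>) * ?g (e *\<^sub>R \<xi>)) = (1 / e) ^ DIM('a) * ?g ((1 / e) *\<^sub>R u)" for u
    proof -
      have "(LINT \<xi>|lborel. cos (u \<bullet> \<xi>) * ?g (e *\<^sub>R \<xi>))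
          = (1 / e) ^ DIM('a) * (LINT \<eta>|lborel. ?g \<eta> * cos (((1 / e) *\<^sub>R u) \<bullet> \<eta>))"
        using e by (subst integral_lborel_affine[of "1/e" _ 0]) (auto simp: mult.commute)
      then show ?thesis
        unfolding integral_std_gaussian_cos g_eq[of "(1 / e) *\<^sub>R u"] by (simp only: mult.left_commute)
    qed
    have "(LINT \<xi>|lborel. ?c \<xi> * cos (x \<bullet> \<xi>) * ?g (e *\<^sub>R \<xi>))
        = (LINT \<xi>|lborel. (LINT y|lborel. \<Phi> y * cos ((x - y) \<bullet> \<xi>) * ?g (e *\<^sub>R \<xi>)))"
      by (simp add: shift)
    also have "\<dots> = (LINT y|lborel. (LINT \<xi>|lborel. \<Phi> y * cos ((x - y) \<bullet> \<xi>) * ?g (e *\<^sub>R \<xi>)))"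
    proof (rule lborel_pair.Fubini_integral)
      have "integrable (lborel \<Otimes>\<^sub>M lborel) (\<lambda>(y, \<xi>). \<Phi> y * ?g (e *\<^sub>R \<xi>))"
      proof (rule lborel_pair.Fubini_integrable)
        show "integrable lborel (\<lambda>y. LINT \<xi>|lborel. norm (case (y, \<xi>) of (y, \<xi>) \<Rightarrow> \<Phi> y * ?g (e *\<^sub>R \<xi>)))"
          using int by (simp add: abs_mult)
      qed (auto intro!: AE_I2 integrable_mult_right ge_int)
      then show "integrable (lborel \<Otimes>\<^sub>M lborel) (\<lambda>(y, \<xi>). \<Phi> y * cos ((x - y) \<bullet> \<xi>) * ?g (e *\<^sub>R \<xi>))"
        by (rule Bochner_Integration.integrable_bound)
          (auto simp: abs_mult intro!: AE_I2 mult_right_mono mult_left_le)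
    qed
    also have "\<dots> = (LINT y|lborel. \<Phi> y * (LINT \<xi>|lborel. cos ((x - y) \<bullet> \<xi>) * ?g (e *\<^sub>R \<xi>)))"
      by (simp add: mult.assoc)
    finally have "k * (LINT \<xi>|lborel. ?c \<xi> * cos (x \<bullet> \<xi>) * ?g (e *\<^sub>R \<xi>))
        = (LINT y|lborel. \<Phi> y * (k * (LINT \<xi>|lborel. cos ((x - y) \<bullet> \<xi>) * ?g (e *\<^sub>R \<xi>))))"
      by (simp add: mult.left_commute)
    also have "\<dots> = (LINT y|lborel. \<Phi> y * ((1 / e) ^ DIM('a) * ?g ((1 / e) *\<^sub>R (x - y))))"
      by (simp only: ft)
    also have "\<dots> = (1 / e) ^ DIM('a) * (LINT y|lborel. \<Phi> y * ?g ((1 / e) *\<^sub>R (x - y)))"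
      by (simp add: mult.left_commute[of "\<Phi> _"])
    \<comment> \<open>Substituting \<open>y = x - e *\<^sub>R z\<close>, whose Jacobian cancels the
      power of \<open>1 / e\<close>.\<close>
    also have "\<dots> = (LINT z|lborel. \<Phi> (x - e *\<^sub>R z) * ?g z)"
      using e by (subst integral_lborel_affine[of "- e" _ x]) (auto simp: power_one_over)
    finally show ?thesis .
  qed
  define e where "e n = inverse (real (Suc n))" for n
  have e: "e n > 0" "e \<longlonglongrightarrow> 0" for n
    using LIMSEQ_inverse_real_of_nat by (auto simp: e_def[abs_def])
  have e_scale: "(\<lambda>n. e n *\<^sub>R v) \<longlonglongrightarrow> 0" for v :: 'a
    using tendsto_scaleR[OF e(2) tendsto_const[of v]] by simp
  have "(\<lambda>n. k * (LINT \<xi>|lborel. ?c \<xi> * cos (x \<bullet> \<xi>) * ?g (e n *\<^sub>R \<xi>)))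
      \<longlonglongrightarrow> k * (LINT \<xi>|lborel. ?c \<xi> * cos (x \<bullet> \<xi>) * ?g 0)"
  proof (intro tendsto_mult_left integral_dominated_convergence[where w="\<lambda>\<xi>. norm (?c \<xi>) * k"])
    show "integrable lborel (\<lambda>\<xi>. norm (?c \<xi>) * k)" using int_transform by simp
    show "AE \<xi> in lborel. (\<lambda>n. ?c \<xi> * cos (x \<bullet> \<xi>) * ?g (e n *\<^sub>R \<xi>)) \<longlonglongrightarrow> ?c \<xi> * cos (x \<bullet> \<xi>) * ?g 0"
      by (intro AE_I2 tendsto_mult_left continuous_on_tendsto_compose[OF continuous_on_std_gaussian[of UNIV]]
          e_scale) auto
    show "AE \<xi> in lborel. norm (?c \<xi> * cos (x \<bullet> \<xi>) * ?g (e n *\<^sub>R \<xi>)) \<le> norm (?c \<xi>) * k" for n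
    proof (rule AE_I2)
      fix \<xi> :: 'a
      have "\<bar>cos (x \<bullet> \<xi>)\<bar> * ?g (e n *\<^sub>R \<xi>) \<le> 1 * k"
        unfolding k_def by (intro mult_mono std_gaussian_le) auto
      then show "norm (?c \<xi> * cos (x \<bullet> \<xi>) * ?g (e n *\<^sub>R \<xi>)) \<le> norm (?c \<xi>) * k"
        by (simp add: abs_mult mult.assoc mult_left_mono)
    qed
  qed measurable
  moreover have "(\<lambda>n. LINT z|lborel. \<Phi> (x - e n *\<^sub>R z) * ?g z) \<longlonglongrightarrow> (LINT z|lborel. \<Phi> x * ?g z)"
  proof (rule integral_dominated_convergence[where w="\<lambda>z. B * ?g z"])
    show "integrable lborel (\<lambda>z. B * ?g z)"
      by (intro integrable_mult_right integrable_std_gaussian)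
    have "(\<lambda>n. x - e n *\<^sub>R z) \<longlonglongrightarrow> x" for z
      using tendsto_diff[OF tendsto_const[of x] e_scale[of z]] by simp
    then show "AE z in lborel. (\<lambda>n. \<Phi> (x - e n *\<^sub>R z) * ?g z) \<longlonglongrightarrow> \<Phi> x * ?g z"
      by (intro AE_I2 tendsto_mult_right continuous_on_tendsto_compose[OF cont]) auto
    show "AE z in lborel. norm (\<Phi> (x - e n *\<^sub>R z) * ?g z) \<le> B * ?g z" for n
      by (auto simp: abs_mult intro!: AE_I2 mult_right_mono bound)
  qed measurable
  ultimately have "k * (LINT \<xi>|lborel. ?c \<xi> * cos (x \<bullet> \<xi>) * ?g 0) = (LINT z|lborel. \<Phi> x * ?g z)"
    by (simp only: regularized[OF e(1)] LIMSEQ_unique)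
  then have "k\<^sup>2 * (LINT \<xi>|lborel. ?c \<xi> * cos (x \<bullet> \<xi>)) = \<Phi> x"
    by (simp add: integral_std_gaussian k_def power2_eq_square mult_ac)
  then have "(LINT \<xi>|lborel. ?c \<xi> * cos (x \<bullet> \<xi>)) = 1 / k\<^sup>2 * \<Phi> x"
    using k by (simp add: field_simps)
  then show ?thesis by (simp only: k2)
qed

section \<open>Elementary consequences of positive definiteness\<close>

lemma positive_definite_sum_nonneg_distinct:
  assumes "positive_definite \<Phi>" and X: "finite X"
  shows "0 \<le> (\<Sum>x\<in>X. \<Sum>y\<in>X. c x * c y * \<Phi> (x - y))"
\<comment> \<open>The definition yields a strict inequality for nonzero coefficients along an
  injective enumeration; when all coefficients vanish on \<open>X\<close> the sum is 0.\<close>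
proof (cases "\<exists>x\<in>X. c x \<noteq> 0")
  case True
  obtain h where h: "bij_betw h {..<card X} X"
    using ex_bij_betw_nat_finite[OF X] by (auto simp: atLeast0LessThan)
  have "0 < (\<Sum>i<card X. \<Sum>j<card X. c (h i) * c (h j) * \<Phi> (h i - h j))"
  proof -
    have "inj_on h {..<card X}" using h by (rule bij_betw_imp_inj_on)
    moreover have "\<exists>i<card X. c (h i) \<noteq> 0"
    proof -
      obtain x where "x \<in> X" "c x \<noteq> 0" using True by blast
      moreover from this obtain i where "i < card X" "x = h i"
        using h by (auto simp: bij_betw_def image_iff)
      ultimately show ?thesis by blast
    qed
    ultimately show ?thesis
      using assms(1)[unfolded positive_definite_def, THEN conjunct2, rule_format, of h "card X" "\<lambda>i. c (h i)"]
      by simp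
  qed
  also have "\<dots> = (\<Sum>i<card X. \<Sum>y\<in>X. c (h i) * c y * \<Phi> (h i - y))"
    by (intro sum.cong refl sum.reindex_bij_betw[OF h])
  also have "\<dots> = (\<Sum>x\<in>X. \<Sum>y\<in>X. c x * c y * \<Phi> (x - y))"
    by (rule sum.reindex_bij_betw[OF h])
  finally show ?thesis by simp
qed simp

text \<open>Repeated points are merged by adding up their coefficients.\<close>

lemma positive_definite_sum_nonneg:
  fixes x :: "nat \<Rightarrow> 'a::ab_group_add"
  assumes "positive_definite \<Phi>"
  shows "0 \<le> (\<Sum>i<n. \<Sum>j<n. c i * c j * \<Phi> (x i - x j))"
proof -
  let ?X = "x ` {..<n}"
  define C where "C u = (\<Sum>i\<in>{i. i < n \<and> x i = u}. c i)" for u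
  have merge: "(\<Sum>i<n. c i * g (x i)) = (\<Sum>u\<in>?X. C u * g u)" for g :: "'a \<Rightarrow> real"
  proof -
    have "(\<Sum>i<n. c i * g (x i)) = (\<Sum>u\<in>?X. \<Sum>i\<in>{i. i \<in> {..<n} \<and> x i = u}. c i * g (x i))"
      by (rule sum.image_gen) simp
    also have "\<dots> = (\<Sum>u\<in>?X. C u * g u)"
      by (simp add: sum_distrib_right C_def)
    finally show ?thesis .
  qed
  have "(\<Sum>i<n. \<Sum>j<n. c i * c j * \<Phi> (x i - x j)) = (\<Sum>i<n. c i * (\<Sum>j<n. c j * \<Phi> (x i - x j)))"
    by (simp add: sum_distrib_left mult.assoc)
  also have "\<dots> = (\<Sum>u\<in>?X. C u * (\<Sum>v\<in>?X. C v * \<Phi> (u - v)))"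
    by (simp only: merge[of "\<lambda>v. \<Phi> (_ - v)"] merge[of "\<lambda>u. \<Sum>v\<in>?X. C v * \<Phi> (u - v)"])
  also have "\<dots> = (\<Sum>u\<in>?X. \<Sum>v\<in>?X. C u * C v * \<Phi> (u - v))"
    by (simp add: sum_distrib_left mult.assoc)
  also have "\<dots> \<ge> 0" by (rule positive_definite_sum_nonneg_distinct[OF assms]) simp
  finally show ?thesis .
qed

lemma positive_definite_even:
  assumes "positive_definite \<Phi>"
  shows "\<Phi> (- x) = \<Phi> x"
proof -
  have "\<Phi> (0 - x) = \<Phi> (x - 0)" using assms unfolding positive_definite_def by blast
  then show ?thesis by simp
qed

text \<open>The quadratic form at the points \<open>x\<close> and 0 with coefficients 1 and
  \<open>a\<close>, for \<open>a\<close> equal to 1 and to -1.\<close>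

lemma positive_definite_bound:
  assumes "positive_definite \<Phi>"
  shows "\<bar>\<Phi> x\<bar> \<le> \<Phi> 0"
proof -
  have "0 \<le> 2 * \<Phi> 0 + 2 * a * \<Phi> x" if "a\<^sup>2 = 1" for a
    using positive_definite_sum_nonneg[OF assms, where n = 2
        and c = "\<lambda>i. if i = 0 then 1 else a" and x = "\<lambda>i. if i = 0 then x else 0"]
      that by (simp add: eval_nat_numeral positive_definite_even[OF assms] power2_eq_square)
  from this[of 1] this[of "-1"] show ?thesis by simp
qed

text \<open>The density of \<open>M\<close> is the cosine transform divided by the constant of
  \<open>cosine_inversion\<close>. Nonnegativity turns the one-sided decay into an absolute bound,
  so multiplying by \<open>exp (b * norm \<xi>)\<close> still leaves exponential decay at rate
  \<open>a - b\<close>.\<close>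

theorem spectral_measure_exists:
  fixes \<Phi> :: "'a::euclidean_space \<Rightarrow> real"
  assumes cont: "continuous_on UNIV \<Phi>"
    and int: "integrable lborel \<Phi>"
    and pd: "positive_definite \<Phi>"
    and a: "0 < a"
    and decay: "\<And>\<xi>. cosine_transform \<Phi> \<xi> \<le> C * exp (- a * norm \<xi>)"
  obtains M :: "'a measure" where
    "finite_measure M" "sets M = sets borel"
    "\<And>b. b < a \<Longrightarrow> integrable M (\<lambda>\<xi>. exp (b * norm \<xi>))"
    "\<And>x. \<Phi> x = (LINT \<xi>|M. cos (x \<bullet> \<xi>))"
proof -
  have [measurable]: "\<Phi> \<in> borel_measurable borel" using int by auto
  let ?k = "(2 * pi) ^ DIM('a) :: real"
  define \<rho> where "\<rho> \<xi> = cosine_transform \<Phi> \<xi> / ?k" for \<xi>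
  define M where "M = density lborel (\<lambda>\<xi>. ennreal (\<rho> \<xi>))"
  have [measurable]: "\<rho> \<in> borel_measurable borel" unfolding \<rho>_def[abs_def] by measurable
  have nonneg: "0 \<le> cosine_transform \<Phi> \<xi>" for \<xi>
    by (rule cosine_transform_nonneg[OF int positive_definite_bound[OF pd] positive_definite_sum_nonneg[OF pd]])
  then have \<rho>_nonneg: "0 \<le> \<rho> \<xi>" for \<xi> by (simp add: \<rho>_def)
  have exp_transform: "integrable lborel (\<lambda>\<xi>. cosine_transform \<Phi> \<xi> * exp (b * norm \<xi>))" if "b < a" for b
  proof (rule Bochner_Integration.integrable_bound)
    show "integrable lborel (\<lambda>\<xi>::'a. C * exp (- (a - b) * norm \<xi>))"
      using that by (intro integrable_mult_right integrable_exp_norm) simp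
    show "AE \<xi> in lborel. norm (cosine_transform \<Phi> \<xi> * exp (b * norm \<xi>)) \<le> norm (C * exp (- (a - b) * norm \<xi>))"
    proof (rule AE_I2)
      fix \<xi> :: 'a
      have "cosine_transform \<Phi> \<xi> * exp (b * norm \<xi>) \<le> C * exp (- a * norm \<xi>) * exp (b * norm \<xi>)"
        by (intro mult_right_mono decay) simp
      also have "\<dots> = C * exp (- (a - b) * norm \<xi>)" by (simp add: mult_exp_exp algebra_simps)
      finally show "norm (cosine_transform \<Phi> \<xi> * exp (b * norm \<xi>)) \<le> norm (C * exp (- (a - b) * norm \<xi>))"
        using nonneg[of \<xi>] by (auto simp: abs_mult intro: order_trans[OF _ mult_right_mono[OF abs_ge_self]])
    qed
  qed measurable
  \<comment> \<open>The exponential moment with \<open>b = 0\<close>; the same choice makes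
    \<open>M\<close> finite below.\<close>
  have int_transform: "integrable lborel (cosine_transform \<Phi>)"
    using exp_transform[OF a] by simp
  have int_M_iff: "integrable M f \<longleftrightarrow> integrable lborel (\<lambda>\<xi>. \<rho> \<xi> * f \<xi>)"
    if "f \<in> borel_measurable borel" for f :: "'a \<Rightarrow> real"
    unfolding M_def using that by (subst integrable_density) (auto simp: \<rho>_nonneg)
  have exp_M: "integrable M (\<lambda>\<xi>. exp (b * norm \<xi>))" if "b < a" for b
    using exp_transform[OF that] by (subst int_M_iff) (auto simp: \<rho>_def)
  have "finite_measure M"
  proof
    have "integrable M (\<lambda>_. 1 :: real)" using exp_M[OF a] by simp
    then show "emeasure M (space M) \<noteq> \<infinity>"
      by (simp add: integrable_iff_bounded less_top)
  qed
  moreover have "\<Phi> x = (LINT \<xi>|M. cos (x \<bullet> \<xi>))" for x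
  proof -
    have "(LINT \<xi>|M. cos (x \<bullet> \<xi>)) = (LINT \<xi>|lborel. \<rho> \<xi> * cos (x \<bullet> \<xi>))"
      unfolding M_def by (subst integral_density) (auto simp: \<rho>_nonneg)
    also have "\<dots> = (LINT \<xi>|lborel. cosine_transform \<Phi> \<xi> * cos (x \<bullet> \<xi>)) / ?k"
      by (simp add: \<rho>_def)
    also have "\<dots> = \<Phi> x"
      by (subst cosine_inversion[OF cont int positive_definite_bound[OF pd] positive_definite_even[OF pd] int_transform]) simp
    finally show ?thesis by simp
  qed
  ultimately show thesis
    using exp_M by (intro that[of M]) (auto simp: M_def)
qed

lemma Re_fourier:
  fixes \<Phi> :: "real ^ 'n \<Rightarrow> real"
  assumes int: "integrable lborel \<Phi>"
  shows "Re (fourier \<Phi> \<xi>) = (2 * pi) powr (- real CARD('n) / 2) * cosine_transform \<Phi> \<xi>"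
proof -
  have [measurable]: "\<Phi> \<in> borel_measurable borel" using int by auto
  have i: "integrable lborel (\<lambda>x. complex_of_real (\<Phi> x) * exp (- (\<i> * complex_of_real (x \<bullet> \<xi>))))"
    by (rule Bochner_Integration.integrable_bound[OF int]) (auto simp: norm_mult)
  have "Re (LINT x|lborel. complex_of_real (\<Phi> x) * exp (- (\<i> * complex_of_real (x \<bullet> \<xi>)))) = cosine_transform \<Phi> \<xi>"
    unfolding cosine_transform_def by (subst integral_Re[OF i, symmetric]) (simp add: Re_exp)
  then show ?thesis unfolding fourier_def by simp
qed

section \<open>Multi-index power series\<close>

text \<open>A finite set of multi-indices lies in a box, and over a box the sum of products is the
  product of partial sums. This bounds all finite sums of norms; absolute summability then permits
  exchanging the product with the infinite sums.\<close>

lemma has_sum_prod_UNIV: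
  fixes f :: "'i::finite \<Rightarrow> nat \<Rightarrow> 'b::{real_normed_field, banach}"
  assumes f: "\<And>k. (f k has_sum S k) UNIV"
    and norm_f: "\<And>k. (\<lambda>n. norm (f k n)) summable_on UNIV"
  shows "((\<lambda>m. \<Prod>k\<in>UNIV. f k (m k)) has_sum (\<Prod>k\<in>UNIV. S k)) UNIV"
proof -
  define B where "B = (\<Prod>k\<in>UNIV. infsum (\<lambda>n. norm (f k n)) UNIV)"
  have "(\<lambda>m. \<Prod>k\<in>UNIV. norm (f k (m k))) summable_on UNIV"
  proof (rule nonneg_bdd_above_summable_on)
    show "bdd_above (sum (\<lambda>m. \<Prod>k\<in>UNIV. norm (f k (m k))) ` {F. F \<subseteq> UNIV \<and> finite F})"
    proof (rule bdd_aboveI2)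
      fix F :: "('i \<Rightarrow> nat) set" assume "F \<in> {F. F \<subseteq> UNIV \<and> finite F}"
      then have F: "finite F" by simp
      \<comment> \<open>A crude side length for the box: the sum of all entries of all members of
        \<open>F\<close>.\<close>
      define N where "N = (\<Sum>m\<in>F. \<Sum>k\<in>UNIV. m k)"
      have N: "m k \<le> N" if "m \<in> F" for m k
      proof -
        have "m k \<le> (\<Sum>k\<in>UNIV. m k)" by (rule member_le_sum) auto
        also have "\<dots> \<le> N" unfolding N_def using F that by (intro member_le_sum) auto
        finally show ?thesis .
      qed
      have "(\<Sum>m\<in>F. \<Prod>k\<in>UNIV. norm (f k (m k)))
          \<le> (\<Sum>m\<in>PiE UNIV (\<lambda>_. {..N}). \<Prod>k\<in>UNIV. norm (f k (m k)))"
        using N by (intro sum_mono2 finite_PiE prod_nonneg) auto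
      also have "\<dots> = (\<Prod>k\<in>UNIV. \<Sum>n\<le>N. norm (f k n))"
        by (subst prod_sum_PiE) auto
      also have "\<dots> \<le> B"
        unfolding B_def
        by (intro prod_mono conjI sum_nonneg finite_sum_le_infsum norm_f) auto
      finally show "(\<Sum>m\<in>F. \<Prod>k\<in>UNIV. norm (f k (m k))) \<le> B" .
    qed
  qed (auto intro: prod_nonneg)
  then have abs: "(\<lambda>m. \<Prod>k\<in>UNIV. f k (m k)) summable_on UNIV"
    using abs_summable_summable[of "\<lambda>m. \<Prod>k\<in>UNIV. f k (m k)" UNIV] by (simp only: prod_norm)
  have "infsum (\<lambda>m. \<Prod>k\<in>UNIV. f k (m k)) (PiE UNIV (\<lambda>_. UNIV)) = (\<Prod>k\<in>UNIV. infsum (f k) UNIV)"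
  proof (rule infsum_prod_PiE)
    show "f k summable_on UNIV" for k using f by (rule has_sum_imp_summable)
  qed (use abs in simp_all)
  also have "\<dots> = (\<Prod>k\<in>UNIV. S k)"
    by (simp add: infsumI[OF f])
  finally show ?thesis using has_sum_infsum[OF abs] by simp
qed

lemma has_sum_multi_exp:
  fixes z :: "'i::finite \<Rightarrow> complex"
  shows "((\<lambda>m. \<Prod>k\<in>UNIV. z k ^ m k / fact (m k)) has_sum exp (\<Sum>k\<in>UNIV. z k)) UNIV"
proof -
  have norm: "summable (\<lambda>n. norm (z k ^ n / fact n))" for k
    using summable_norm_exp[of "z k"] by (simp add: scaleR_conv_of_real divide_inverse mult.commute)
  have "((\<lambda>n. z k ^ n / fact n) has_sum exp (z k)) UNIV" for k
    by (rule norm_summable_imp_has_sum[OF norm])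
      (use exp_converges[of "z k"] in \<open>simp add: scaleR_conv_of_real divide_inverse mult.commute\<close>)
  then have "((\<lambda>m. \<Prod>k\<in>UNIV. z k ^ m k / fact (m k)) has_sum (\<Prod>k\<in>UNIV. exp (z k))) UNIV"
    by (rule has_sum_prod_UNIV) (rule norm_summable_imp_summable_on, use norm in simp)
  then show ?thesis by (simp add: exp_sum)
qed

lemma has_sum_multi_geometric:
  fixes q :: "'i::finite \<Rightarrow> real"
  assumes "\<And>k. 0 \<le> q k" "\<And>k. q k < 1"
  shows "((\<lambda>m. \<Prod>k\<in>UNIV. q k ^ m k) has_sum (\<Prod>k\<in>UNIV. 1 / (1 - q k))) UNIV"
proof (rule has_sum_prod_UNIV)
  show 1: "((\<lambda>n. q k ^ n) has_sum 1 / (1 - q k)) UNIV" for k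
    using assms[of k] 
    by (intro norm_summable_imp_has_sum geometric_sums) (simp_all add: power_abs summable_geometric)
  show "(\<lambda>n. norm (q k ^ n)) summable_on UNIV" for k
    using has_sum_imp_summable[OF 1[of k]] assms[of k] by (simp add: power_abs)
qed

text \<open>Termwise domination on \<open>G - F\<close>, followed by the limit over
  \<open>G\<close>. In the application \<open>w\<close> is independent of the frequency, so the
  remainder is controlled by one number times the weight.\<close>

lemma norm_has_sum_tail_le:
  fixes u :: "'i \<Rightarrow> 'b::real_normed_vector"
  assumes u: "(u has_sum U) UNIV" and w: "(w has_sum T) UNIV"
    and bound: "\<And>m. norm (u m) \<le> K * w m" and F: "finite F"
  shows "norm (U - sum u F) \<le> K * (T - sum w F)"
proof -
  have "((\<lambda>G. norm (sum u G - sum u F)) \<longlongrightarrow> norm (U - sum u F)) (finite_subsets_at_top UNIV)"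
    using u unfolding has_sum_def by (intro tendsto_intros)
  moreover have "((\<lambda>G. K * (sum w G - sum w F)) \<longlongrightarrow> K * (T - sum w F)) (finite_subsets_at_top UNIV)"
    using w unfolding has_sum_def by (intro tendsto_intros)
  moreover have "\<forall>\<^sub>F G in finite_subsets_at_top UNIV. norm (sum u G - sum u F) \<le> K * (sum w G - sum w F)"
  proof (rule eventually_mono)
    show "\<forall>\<^sub>F G in finite_subsets_at_top UNIV. finite G \<and> F \<subseteq> G"
      using F by (auto simp: eventually_finite_subsets_at_top)
    fix G assume "finite G \<and> F \<subseteq> G"
    then have G: "finite G" "F \<subseteq> G" by auto
    have "norm (sum u G - sum u F) = norm (sum u (G - F))" using G by (simp add: sum_diff)
    also have "\<dots> \<le> (\<Sum>m\<in>G - F. K * w m)" by (rule sum_norm_le) (rule bound)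
    also have "\<dots> = K * (sum w G - sum w F)" using G by (simp add: sum_diff sum_distrib_left[symmetric])
    finally show "norm (sum u G - sum u F) \<le> K * (sum w G - sum w F)" .
  qed
  ultimately show ?thesis
    by (intro tendsto_le[OF finite_subsets_at_top_neq_bot])
qed

section \<open>Identity theorem for power series\<close>

lemma sums_eq_zero_imp_coeffs_zero:
  fixes b :: "nat \<Rightarrow> real"
  assumes r: "r > 0" "\<And>z. \<bar>z\<bar> < r \<Longrightarrow> (\<lambda>n. b n * z ^ n) sums f z"
    and d: "d > 0" "\<And>z. \<bar>z\<bar> < d \<Longrightarrow> f z = 0"
  shows "b n = 0"
proof (rule ccontr)
  assume bn: "b n \<noteq> 0"
  \<comment> \<open>The coefficient of index 0 is the value at the centre. A nonzero coefficient of
    positive index would make this zero isolated, against the vanishing near 0.\<close>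
  have f0: "f 0 = 0" using d by simp
  have "(\<lambda>n. b n * 0 ^ n) sums 0" using r(2)[of 0] r(1) f0 by simp
  then have "b 0 = 0" using powser_sums_zero[of b] by (rule sums_unique2[symmetric])
  with bn have n: "n > 0" by (cases n) auto
  obtain s where s: "0 < s" "\<And>z. z \<in> cball 0 s - {0} \<Longrightarrow> f z \<noteq> 0"
  proof (rule powser_0_nonzero)
    show "(\<lambda>n. b n * (z - 0) ^ n) sums f z" if "norm (z - 0) < r" for z
      using r(2)[of z] that by simp
  qed (use r(1) f0 bn n in auto)
  have "f (min s d / 2) \<noteq> 0" using s d(1) by (intro s(2)) auto
  then show False using s(1) d by simp
qed

text \<open>On a segment issuing from the centre a multi-index power series is a power series in the
  parameter, whose coefficients collect the terms of equal total degree.\<close>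

lemma multi_power_series_zero:
  fixes f :: "real ^ 'n \<Rightarrow> real"
  assumes f: "\<And>x. x \<in> ball x0 r \<Longrightarrow>
      ((\<lambda>m. a m * (\<Prod>i\<in>UNIV. (x $ i - x0 $ i) ^ m i)) has_sum f x) UNIV"
    and zero: "d > 0" "\<And>x. x \<in> ball x0 d \<Longrightarrow> f x = 0"
    and x: "x \<in> ball x0 r"
  shows "f x = 0"
proof (cases "x = x0")
  case True
  then show ?thesis using zero by simp
next
  case False
  define v where "v = x - x0"
  have v: "0 < norm v" "norm v < r" using False x by (auto simp: v_def dist_norm norm_minus_commute)
  let ?D = "\<lambda>n. {m :: 'n \<Rightarrow> nat. sum m UNIV = n}"
  have fin: "finite (?D n)" for n
  proof (rule finite_subset)
    show "?D n \<subseteq> PiE UNIV (\<lambda>_. {..n})"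
    proof
      fix m :: "'n \<Rightarrow> nat" assume "m \<in> ?D n"
      then have "m k \<le> n" for k using member_le_sum[of k UNIV m] by simp
      then show "m \<in> PiE UNIV (\<lambda>_. {..n})" by (auto simp: PiE_def)
    qed
    show "finite (PiE (UNIV :: 'n set) (\<lambda>_. {..n}))" by (rule finite_PiE) simp_all
  qed
  define b where "b n = (\<Sum>m\<in>?D n. a m * (\<Prod>i\<in>UNIV. (v $ i) ^ m i))" for n
  have sums: "(\<lambda>n. b n * z ^ n) sums f (x0 + z *\<^sub>R v)" if z: "\<bar>z\<bar> < r / norm v" for z
  proof -
    let ?t = "\<lambda>m. a m * (\<Prod>i\<in>UNIV. (z * v $ i) ^ m i)"
    have t_eq: "?t m = (a m * (\<Prod>i\<in>UNIV. (v $ i) ^ m i)) * z ^ sum m UNIV" for m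
      by (simp add: power_mult_distrib prod.distrib power_sum)
    have "x0 + z *\<^sub>R v \<in> ball x0 r" using z v by (simp add: dist_norm field_simps)
    from f[OF this] have "(?t has_sum f (x0 + z *\<^sub>R v)) UNIV" by simp
    also have "?this \<longleftrightarrow> ((\<lambda>p. ?t (snd p)) has_sum f (x0 + z *\<^sub>R v)) (SIGMA n:UNIV. ?D n)"
      by (rule has_sum_reindex_bij_witness[of _ snd "\<lambda>m. (sum m UNIV, m)"]) auto
    finally have "((\<lambda>n. b n * z ^ n) has_sum f (x0 + z *\<^sub>R v)) UNIV"
    proof (rule has_sum_SigmaD)
      show "((\<lambda>m. ?t (snd (n, m))) has_sum b n * z ^ n) (?D n)" for n
        using fin by (intro has_sum_finiteI) (auto simp: b_def t_eq sum_distrib_right intro!: sum.cong)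
    qed
    then show ?thesis by (rule has_sum_imp_sums)
  qed
  have "b n = 0" for n
  proof (rule sums_eq_zero_imp_coeffs_zero[OF _ sums])
    show "0 < r / norm v" "0 < d / norm v" using v zero(1) by (simp_all add: order.strict_trans[OF v])
    show "f (x0 + z *\<^sub>R v) = 0" if "\<bar>z\<bar> < d / norm v" for z
      using that v by (intro zero) (simp add: dist_norm field_simps)
  qed
  \<comment> \<open>The point \<open>x\<close> has parameter 1, which is admissible because
    \<open>norm v < r\<close>.\<close>
  then have "(\<lambda>n. 0) sums f (x0 + 1 *\<^sub>R v)" using sums[of 1] v by simp
  then have "f (x0 + 1 *\<^sub>R v) = 0" using sums_zero by (rule sums_unique2)
  then show ?thesis by (simp add: v_def)
qed

text \<open>The interior \<open>Z\<close> of the zero set is open by construction. It is also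
  closed: a limit of points of \<open>Z\<close> is within \<open>r\<close> of one of them, and that
  one has its whole ball of radius \<open>r\<close> in \<open>Z\<close>. Connectedness does the
  rest.\<close>

lemma uniformly_analytic_zero:
  fixes f :: "real ^ 'n \<Rightarrow> real"
  assumes r: "r > 0"
    and analytic: "\<And>x0. \<exists>a. \<forall>x\<in>ball x0 r.
      ((\<lambda>m. a m * (\<Prod>i\<in>UNIV. (x $ i - x0 $ i) ^ m i)) has_sum f x) UNIV"
    and U: "open U" "U \<noteq> {}" "\<And>x. x \<in> U \<Longrightarrow> f x = 0"
  shows "f x = 0"
proof -
  define Z where "Z = interior {x. f x = 0}"
  have spread: "ball x0 r \<subseteq> Z" if "x0 \<in> Z" for x0
  proof -
    from that obtain d where d: "d > 0" "ball x0 d \<subseteq> Z"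
      by (metis Z_def open_interior open_contains_ball)
    then have "ball x0 d \<subseteq> {x. f x = 0}" unfolding Z_def using interior_subset by blast
    then have zero: "\<And>x. x \<in> ball x0 d \<Longrightarrow> f x = 0" by blast
    obtain a where "\<forall>x\<in>ball x0 r.
        ((\<lambda>m. a m * (\<Prod>i\<in>UNIV. (x $ i - x0 $ i) ^ m i)) has_sum f x) UNIV"
      using analytic by blast
    then have "f x = 0" if "x \<in> ball x0 r" for x
      using multi_power_series_zero[of x0 r a f d x] d zero that by blast
    then show ?thesis unfolding Z_def by (intro interior_maximal) auto
  qed
  have "closed Z"
    unfolding closed_sequential_limits
  proof (intro allI impI, elim conjE)
    fix X l assume X: "\<forall>n. X n \<in> Z" "X \<longlonglongrightarrow> l"
    then obtain n where "dist (X n) l < r" using r unfolding lim_sequentially by blast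
    then show "l \<in> Z" using spread[of "X n"] X(1) by auto
  qed
  moreover have "open Z" by (simp add: Z_def)
  moreover have "Z \<noteq> {}" using U interior_maximal[of U "{x. f x = 0}"] by (auto simp: Z_def)
  ultimately have "Z = UNIV" using clopen[of Z] by blast
  then show ?thesis using interior_subset[of "{x. f x = 0}"] by (auto simp: Z_def)
qed

section \<open>Power series expansion in the reproducing kernel Hilbert space\<close>

lemma integral_Cauchy_Schwarz:
  fixes u v :: "'a \<Rightarrow> real"
  assumes [measurable]: "u \<in> borel_measurable M" "v \<in> borel_measurable M"
    and u: "integrable M (\<lambda>x. (u x)\<^sup>2)" and v: "integrable M (\<lambda>x. (v x)\<^sup>2)"
  shows "integrable M (\<lambda>x. u x * v x)"
    and "(LINT x|M. u x * v x)\<^sup>2 \<le> (LINT x|M. (u x)\<^sup>2) * (LINT x|M. (v x)\<^sup>2)"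
proof -
  have bound: "\<bar>a * b\<bar> \<le> a\<^sup>2 + b\<^sup>2" for a b :: real
  proof -
    have "2 * (\<bar>a\<bar> * \<bar>b\<bar>) \<le> a\<^sup>2 + b\<^sup>2" using sum_squares_bound[of "\<bar>a\<bar>" "\<bar>b\<bar>"] by simp
    moreover have "0 \<le> \<bar>a\<bar> * \<bar>b\<bar>" by simp
    ultimately show ?thesis unfolding abs_mult by linarith
  qed
  show int: "integrable M (\<lambda>x. u x * v x)"
    by (rule Bochner_Integration.integrable_bound[OF Bochner_Integration.integrable_add[OF u v]])
      (auto intro!: AE_I2 bound)
  let ?A = "LINT x|M. (u x)\<^sup>2" and ?C = "LINT x|M. u x * v x" and ?D = "LINT x|M. (v x)\<^sup>2"
  have quad: "0 \<le> ?A - 2 * t * ?C + t\<^sup>2 * ?D" for t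
  proof -
    have "0 \<le> (LINT x|M. (u x - t * v x)\<^sup>2)" by (intro integral_nonneg_AE) simp
    also have "\<dots> = (LINT x|M. (u x)\<^sup>2 - 2 * t * (u x * v x) + t\<^sup>2 * (v x)\<^sup>2)"
      by (simp add: power2_diff power_mult_distrib algebra_simps)
    also have "\<dots> = ?A - 2 * t * ?C + t\<^sup>2 * ?D"
      using u v int by simp
    finally show ?thesis .
  qed
  have D: "0 \<le> ?D" by (intro integral_nonneg_AE) simp
  show "?C\<^sup>2 \<le> ?A * ?D"
  proof (cases "?D = 0")
    case True
    have "?C = 0"
    proof (rule ccontr)
      assume "?C \<noteq> 0"
      \<comment> \<open>With \<open>?D = 0\<close> the quadratic is linear in \<open>t\<close>, and
        this \<open>t\<close> gives it the value -1.\<close>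
      then show False using quad[of "(?A + 1) / (2 * ?C)"] True by simp
    qed
    then show ?thesis using True by simp
  next
    case False
    then have "0 < ?D" using D by linarith
    then show ?thesis using quad[of "?C / ?D"] by (simp add: power2_eq_square field_simps zero_le_divide_iff)
  qed
qed

lemma power_over_fact_le_exp:
  fixes u :: real
  assumes "0 \<le> u"
  shows "u ^ n / fact n \<le> exp u"
proof -
  have sums: "(\<lambda>n. u ^ n /\<^sub>R fact n) sums exp u" by (rule exp_converges)
  have "(\<Sum>i\<in>{n}. u ^ i /\<^sub>R fact i) \<le> (\<Sum>i. u ^ i /\<^sub>R fact i)"
    using assms by (intro sum_le_suminf sums_summable[OF sums]) auto
  also have "\<dots> = exp u" by (rule sums_unique[OF sums, symmetric])
  finally show ?thesis by (simp add: divide_inverse mult.commute)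
qed

text \<open>In the application the squared weight is dominated by \<open>exp (\<alpha> \<parallel>\<xi>\<parallel> / 2)\<close>.\<close>

locale spectral_rkhs =
  rkhs "\<lambda>x y. \<Phi> (x - y)" H ip + finite_measure M
  for \<Phi> :: "real ^ 'n \<Rightarrow> real" and H ip and M :: "(real ^ 'n) measure" +
  fixes s :: real
  assumes s: "0 < s"
    and sets_M: "sets M = sets borel"
    and spectral: "\<And>x. \<Phi> x = (LINT \<xi>|M. cos (x \<bullet> \<xi>))"
    and weight_integrable: "integrable M (\<lambda>\<xi>. (exp (s * (\<Sum>k\<in>UNIV. \<bar>\<xi> $ k\<bar>)))\<^sup>2)"
begin

declare sets_M[measurable_cong]

text \<open>The sum of absolute coordinates makes the weight a product over the coordinates, as the
  monomials are.\<close>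

definition weight :: "real ^ 'n \<Rightarrow> real" where
  "weight \<xi> = exp (s * (\<Sum>k\<in>UNIV. \<bar>\<xi> $ k\<bar>))"

definition feature :: "(real ^ 'n \<Rightarrow> complex) \<Rightarrow> real ^ 'n \<Rightarrow> real" where
  "feature h x = (LINT \<xi>|M. Re (cis (- (x \<bullet> \<xi>)) * h \<xi>))"

lemma weight_pos: "0 < weight \<xi>"
  by (simp add: weight_def)

lemma measurable_weight[measurable]: "weight \<in> borel_measurable borel"
  unfolding weight_def[abs_def] by measurable

lemma integrable_weight_square: "integrable M (\<lambda>\<xi>. (weight \<xi>)\<^sup>2)"
  using weight_integrable by (simp add: weight_def)

lemma integrable_weight: "integrable M weight"
  using integral_Cauchy_Schwarz(1)[of weight M "\<lambda>_. 1"] integrable_weight_square by simp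

lemma measurable_cis[measurable]: "cis \<in> borel_measurable borel"
  unfolding cis_conv_exp by (intro borel_measurable_continuous_onI continuous_intros)

lemma integrable_dominated_by_weight:
  fixes h :: "real ^ 'n \<Rightarrow> complex"
  assumes [measurable]: "h \<in> borel_measurable borel" and h: "\<And>\<xi>. norm (h \<xi>) \<le> B * weight \<xi>"
  shows "integrable M (\<lambda>\<xi>. Re (cis (- (x \<bullet> \<xi>)) * h \<xi>))"
proof (rule Bochner_Integration.integrable_bound[OF integrable_mult_right[OF integrable_weight, of B]])
  show "AE \<xi> in M. norm (Re (cis (- (x \<bullet> \<xi>)) * h \<xi>)) \<le> norm (B * weight \<xi>)"
  proof (rule AE_I2)
    fix \<xi>
    have "norm (Re (cis (- (x \<bullet> \<xi>)) * h \<xi>)) \<le> norm (cis (- (x \<bullet> \<xi>)) * h \<xi>)"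
      unfolding real_norm_def by (rule abs_Re_le_cmod)
    also have "\<dots> \<le> B * weight \<xi>" using h by (simp add: norm_mult)
    finally show "norm (Re (cis (- (x \<bullet> \<xi>)) * h \<xi>)) \<le> norm (B * weight \<xi>)" by simp
  qed
qed measurable

text \<open>The norm bound is linear in \<open>B\<close>. A remainder dominated by a small multiple
  of the weight therefore has a small norm in \<open>H\<close>.\<close>

lemma feature_in_rkhs:
  fixes h :: "real ^ 'n \<Rightarrow> complex"
  assumes h[measurable]: "h \<in> borel_measurable borel"
    and bound: "\<And>\<xi>. norm (h \<xi>) \<le> B * weight \<xi>" and B: "0 \<le> B"
  shows "feature h \<in> H" "nrm (feature h) \<le> B * sqrt (LINT \<xi>|M. (weight \<xi>)\<^sup>2)"
proof -
  let ?W = "LINT \<xi>|M. (weight \<xi>)\<^sup>2"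
  have W: "0 \<le> ?W" by (intro integral_nonneg_AE) simp
  have key: "(\<Sum>x\<in>X. c x * feature h x)\<^sup>2
      \<le> (B * sqrt ?W)\<^sup>2 * (\<Sum>x\<in>X. \<Sum>y\<in>X. c x * c y * \<Phi> (x - y))" if X: "finite X" for X c
  proof -
    define g where "g \<xi> = (\<Sum>x\<in>X. complex_of_real (c x) * cis (- (x \<bullet> \<xi>)))" for \<xi>
    have g[measurable]: "g \<in> borel_measurable borel" unfolding g_def[abs_def] by measurable
    have g_square: "(norm (g \<xi>))\<^sup>2 = (\<Sum>x\<in>X. \<Sum>y\<in>X. c x * c y * cos ((x - y) \<bullet> \<xi>))" for \<xi>
    proof -
      have "(norm (g \<xi>))\<^sup>2 = (\<Sum>x\<in>X. c x * cos (x \<bullet> \<xi>))\<^sup>2 + (\<Sum>x\<in>X. c x * sin (x \<bullet> \<xi>))\<^sup>2"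
        by (simp add: cmod_power2 g_def sum_negf)
      also have "\<dots> = (\<Sum>x\<in>X. \<Sum>y\<in>X. c x * c y * cos ((x - y) \<bullet> \<xi>))"
        by (simp add: power2_eq_square sum_product sum.distrib[symmetric] inner_diff_left cos_diff algebra_simps)
      finally show ?thesis .
    qed
    have cos_int: "integrable M (\<lambda>\<xi>. cos (x \<bullet> \<xi>))" for x
      by (rule integrable_const_bound[where B=1]) auto
    have g_int: "integrable M (\<lambda>\<xi>. (norm (g \<xi>))\<^sup>2)"
      unfolding g_square by (intro Bochner_Integration.integrable_sum integrable_mult_right cos_int)
    have g_integral: "(LINT \<xi>|M. (norm (g \<xi>))\<^sup>2) = (\<Sum>x\<in>X. \<Sum>y\<in>X. c x * c y * \<Phi> (x - y))"
      unfolding g_square spectral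
      by (subst Bochner_Integration.integral_sum, intro Bochner_Integration.integrable_sum integrable_mult_right cos_int,
          subst Bochner_Integration.integral_sum, intro integrable_mult_right cos_int) simp
    have Bw: "integrable M (\<lambda>\<xi>. (B * weight \<xi>)\<^sup>2)" "(LINT \<xi>|M. (B * weight \<xi>)\<^sup>2) = (B * sqrt ?W)\<^sup>2"
      using integrable_weight_square W by (simp_all add: power_mult_distrib)
    have "(\<Sum>x\<in>X. c x * feature h x) = (\<Sum>x\<in>X. LINT \<xi>|M. c x * Re (cis (- (x \<bullet> \<xi>)) * h \<xi>))"
      unfolding feature_def by simp
    also have "\<dots> = (LINT \<xi>|M. (\<Sum>x\<in>X. c x * Re (cis (- (x \<bullet> \<xi>)) * h \<xi>)))"
      by (rule Bochner_Integration.integral_sum[symmetric])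
        (intro integrable_mult_right integrable_dominated_by_weight[OF h bound])
    also have "\<dots> = (LINT \<xi>|M. Re (g \<xi> * h \<xi>))"
      by (rule Bochner_Integration.integral_cong[OF refl])
        (simp add: g_def sum_distrib_right sum_distrib_left sum_subtractf algebra_simps)
    finally have eq: "(\<Sum>x\<in>X. c x * feature h x) = (LINT \<xi>|M. Re (g \<xi> * h \<xi>))" .
    have le: "\<bar>Re (g \<xi> * h \<xi>)\<bar> \<le> norm (g \<xi>) * (B * weight \<xi>)" for \<xi>
    proof -
      have "\<bar>Re (g \<xi> * h \<xi>)\<bar> \<le> norm (g \<xi>) * norm (h \<xi>)"
        using abs_Re_le_cmod[of "g \<xi> * h \<xi>"] by (simp add: norm_mult)
      also have "\<dots> \<le> norm (g \<xi>) * (B * weight \<xi>)" by (intro mult_left_mono bound) simp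
      finally show ?thesis .
    qed
    have gw: "integrable M (\<lambda>\<xi>. norm (g \<xi>) * (B * weight \<xi>))"
      by (rule integral_Cauchy_Schwarz(1)[OF _ _ g_int Bw(1)]) measurable
    have re: "integrable M (\<lambda>\<xi>. Re (g \<xi> * h \<xi>))"
      by (rule Bochner_Integration.integrable_bound[OF gw])
        (auto intro!: AE_I2 order_trans[OF le abs_ge_self] simp del: times_complex.sel)
    have "\<bar>LINT \<xi>|M. Re (g \<xi> * h \<xi>)\<bar> \<le> (LINT \<xi>|M. \<bar>Re (g \<xi> * h \<xi>)\<bar>)"
      by (rule integral_abs_bound)
    also have "\<dots> \<le> (LINT \<xi>|M. norm (g \<xi>) * (B * weight \<xi>))"
      by (intro Bochner_Integration.integral_mono integrable_abs re gw le)
    finally have "\<bar>LINT \<xi>|M. Re (g \<xi> * h \<xi>)\<bar> \<le> (LINT \<xi>|M. norm (g \<xi>) * (B * weight \<xi>))" .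
    then have "(LINT \<xi>|M. Re (g \<xi> * h \<xi>))\<^sup>2 \<le> (LINT \<xi>|M. norm (g \<xi>) * (B * weight \<xi>))\<^sup>2"
      by (metis abs_ge_zero power2_abs power_mono)
    also have "\<dots> \<le> (LINT \<xi>|M. (norm (g \<xi>))\<^sup>2) * (LINT \<xi>|M. (B * weight \<xi>)\<^sup>2)"
      by (rule integral_Cauchy_Schwarz(2)[OF _ _ g_int Bw(1)]) measurable
    finally show ?thesis by (simp only: eq g_integral Bw(2) mult.commute)
  qed
  show "feature h \<in> H" "nrm (feature h) \<le> B * sqrt ?W"
    using memI_bounded_functional[OF _ key] B W by auto
qed

text \<open>The Taylor coefficient of \<open>cis (t \<bullet> \<xi>)\<close> at the power of
  \<open>t\<close> with multi-index \<open>m\<close>, with the factorials and the powers of the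
  imaginary unit included.\<close>

definition monomial :: "('n \<Rightarrow> nat) \<Rightarrow> real ^ 'n \<Rightarrow> complex" where
  "monomial m \<xi> = (\<Prod>k\<in>UNIV. (\<i> * complex_of_real (\<xi> $ k)) ^ m k / fact (m k))"

lemma measurable_monomial[measurable]: "monomial m \<in> borel_measurable borel"
  unfolding monomial_def[abs_def] by measurable

text \<open>In each coordinate, \<open>(s * \<bar>\<xi> $ k\<bar>) ^ m k / fact (m k)\<close> is one
  term of the series of \<open>exp (s * \<bar>\<xi> $ k\<bar>)\<close>.\<close>

lemma norm_monomial_le: "norm (monomial m \<xi>) \<le> (\<Prod>k\<in>UNIV. (1 / s) ^ m k) * weight \<xi>"
proof -
  have one: "norm ((\<i> * complex_of_real (\<xi> $ k)) ^ m k / fact (m k)) \<le> (1 / s) ^ m k * exp (s * \<bar>\<xi> $ k\<bar>)" for k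
  proof -
    have "(s * \<bar>\<xi> $ k\<bar>) ^ m k / fact (m k) \<le> exp (s * \<bar>\<xi> $ k\<bar>)"
      using s by (intro power_over_fact_le_exp) simp
    then show ?thesis using s
      by (simp add: norm_divide norm_power norm_mult power_mult_distrib power_one_over field_simps)
  qed
  have "norm (monomial m \<xi>) \<le> (\<Prod>k\<in>UNIV. (1 / s) ^ m k * exp (s * \<bar>\<xi> $ k\<bar>))"
    unfolding monomial_def prod_norm[symmetric] using one by (intro prod_mono) auto
  also have "\<dots> = (\<Prod>k\<in>UNIV. (1 / s) ^ m k) * weight \<xi>"
    by (simp add: prod.distrib weight_def sum_distrib_left exp_sum)
  finally show ?thesis .
qed

text \<open>For a finite set \<open>F\<close> of multi-indices, the difference between
  \<open>f x\<close> and the partial sum is the inner product of \<open>f\<close> with the feature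
  of the Taylor remainder of \<open>cis (x \<bullet> \<xi>)\<close>. The remainder is at most the
  tail of a multi-geometric series times the weight, so Cauchy-Schwarz bounds the error by a
  multiple of that tail.\<close>

lemma power_series_expansion:
  assumes f: "f \<in> H" and x: "x \<in> ball x0 (s / 2)"
  shows "((\<lambda>m. ip f (feature (\<lambda>\<xi>. cis (x0 \<bullet> \<xi>) * monomial m \<xi>))
    * (\<Prod>k\<in>UNIV. (x $ k - x0 $ k) ^ m k)) has_sum f x) UNIV"
proof -
  define D where "D m \<xi> = cis (x0 \<bullet> \<xi>) * monomial m \<xi>" for m \<xi>
  define t where "t = x - x0"
  define p where "p m = (\<Prod>k\<in>UNIV. (t $ k) ^ m k)" for m :: "'n \<Rightarrow> nat"
  \<comment> \<open>The geometric majorant: the powers of \<open>1 / s\<close> lost in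
    \<open>norm_monomial_le\<close> are combined with those of \<open>t\<close>. The coordinates of
    \<open>t\<close> are below \<open>s\<close>, so it converges.\<close>
  define w where "w m = (\<Prod>k\<in>UNIV. (\<bar>t $ k\<bar> / s) ^ m k)" for m :: "'n \<Rightarrow> nat"
  define T where "T = (\<Prod>k\<in>UNIV. 1 / (1 - \<bar>t $ k\<bar> / s))"
  let ?W = "sqrt (LINT \<xi>|M. (weight \<xi>)\<^sup>2)"
  have t: "\<bar>t $ k\<bar> / s < 1" for k
    using component_le_norm_cart[of t k] x s by (simp add: t_def dist_norm norm_minus_commute)
  have w: "(w has_sum T) UNIV"
    unfolding w_def[abs_def] T_def using s t by (intro has_sum_multi_geometric) auto
  have Dm[measurable]: "D m \<in> borel_measurable borel" for m unfolding D_def[abs_def] by measurable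
  have D_bound: "norm (D m \<xi>) \<le> (\<Prod>k\<in>UNIV. (1 / s) ^ m k) * weight \<xi>" for m \<xi>
    using norm_monomial_le by (simp add: D_def norm_mult)
  have DH: "feature (D m) \<in> H" for m
    using s by (intro feature_in_rkhs[OF Dm D_bound] prod_nonneg) simp
  have Kx: "feature (\<lambda>\<xi>. cis (x \<bullet> \<xi>)) = (\<lambda>y. \<Phi> (y - x))"
  proof
    fix y
    have "Re (cis (- (y \<bullet> \<xi>)) * cis (x \<bullet> \<xi>)) = cos ((y - x) \<bullet> \<xi>)" for \<xi>
      unfolding inner_diff_left cos_diff by simp
    then show "feature (\<lambda>\<xi>. cis (x \<bullet> \<xi>)) y = \<Phi> (y - x)" unfolding feature_def spectral by simp
  qed
  have error: "\<bar>f x - (\<Sum>m\<in>F. ip f (feature (D m)) * p m)\<bar> \<le> (nrm f * ?W) * (T - sum w F)" if F: "finite F" for F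
  proof -
    define h where "h \<xi> = cis (x \<bullet> \<xi>) - (\<Sum>m\<in>F. complex_of_real (p m) * D m \<xi>)" for \<xi>
    have h[measurable]: "h \<in> borel_measurable borel" unfolding h_def[abs_def] by measurable
    have h_bound: "norm (h \<xi>) \<le> (T - sum w F) * weight \<xi>" for \<xi>
    proof -
      define u where "u m = (\<Prod>k\<in>UNIV. (\<i> * complex_of_real (t $ k * \<xi> $ k)) ^ m k / fact (m k))" for m
      have u_eq: "u m = complex_of_real (p m) * monomial m \<xi>" for m
        by (simp add: u_def p_def monomial_def power_mult_distrib prod.distrib[symmetric] mult_ac)
      have "(u has_sum exp (\<Sum>k\<in>UNIV. \<i> * complex_of_real (t $ k * \<xi> $ k))) UNIV"
        unfolding u_def[abs_def] by (rule has_sum_multi_exp)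
      also have "(\<Sum>k\<in>UNIV. \<i> * complex_of_real (t $ k * \<xi> $ k)) = \<i> * complex_of_real (t \<bullet> \<xi>)"
        by (simp add: inner_vec_def sum_distrib_left)
      finally have u: "(u has_sum cis (t \<bullet> \<xi>)) UNIV" by (simp add: cis_conv_exp)
      have "norm (u m) \<le> weight \<xi> * w m" for m
      proof -
        have "norm (u m) \<le> \<bar>p m\<bar> * ((\<Prod>k\<in>UNIV. (1 / s) ^ m k) * weight \<xi>)"
          unfolding u_eq norm_mult using norm_monomial_le by (simp add: mult_left_mono)
        also have "\<dots> = weight \<xi> * w m"
          by (simp add: p_def w_def abs_prod power_abs prod.distrib power_divide prod_dividef power_one_over)
        finally show ?thesis .
      qed
      from norm_has_sum_tail_le[OF u w this F]
      have "norm (cis (t \<bullet> \<xi>) - sum u F) \<le> weight \<xi> * (T - sum w F)" .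
      moreover have "h \<xi> = cis (x0 \<bullet> \<xi>) * (cis (t \<bullet> \<xi>) - sum u F)"
        by (simp add: h_def D_def t_def u_eq cis_mult inner_diff_left right_diff_distrib sum_distrib_left mult_ac)
      ultimately show ?thesis by (simp add: norm_mult mult.commute)
    qed
    \<comment> \<open>The bound on \<open>h\<close> at a single frequency suffices, since the weight
      is positive there.\<close>
    have T: "0 \<le> T - sum w F"
      using order_trans[OF norm_ge_zero h_bound[of 0]] weight_pos[of 0] by (simp add: zero_le_mult_iff)
    have feature_h: "feature h = (\<lambda>y. \<Phi> (y - x) - (\<Sum>m\<in>F. p m * feature (D m) y))"
    proof
      fix y
      have cis_int: "integrable M (\<lambda>\<xi>. Re (cis (- (y \<bullet> \<xi>)) * cis (x \<bullet> \<xi>)))"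
        by (rule integrable_const_bound[where B=1]) (auto simp: cis_mult)
      have D_int: "integrable M (\<lambda>\<xi>. p m * Re (cis (- (y \<bullet> \<xi>)) * D m \<xi>))" for m
        by (intro integrable_mult_right integrable_dominated_by_weight[OF Dm D_bound])
      have "feature h y = (LINT \<xi>|M. Re (cis (- (y \<bullet> \<xi>)) * cis (x \<bullet> \<xi>))
          - (\<Sum>m\<in>F. p m * Re (cis (- (y \<bullet> \<xi>)) * D m \<xi>)))"
        unfolding feature_def h_def
        by (rule Bochner_Integration.integral_cong[OF refl])
          (simp add: sum_distrib_left sum_subtractf sum.distrib algebra_simps)
      also have "\<dots> = feature (\<lambda>\<xi>. cis (x \<bullet> \<xi>)) y - (\<Sum>m\<in>F. p m * feature (D m) y)"
        unfolding feature_def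
        by (subst Bochner_Integration.integral_diff[OF cis_int Bochner_Integration.integrable_sum[OF D_int]],
            subst Bochner_Integration.integral_sum[OF D_int]) simp
      finally show "feature h y = \<Phi> (y - x) - (\<Sum>m\<in>F. p m * feature (D m) y)" by (simp add: Kx)
    qed
    have "f x - (\<Sum>m\<in>F. ip f (feature (D m)) * p m) = ip f (feature h)"
      unfolding feature_h using f
      by (simp add: ip_diff_right ip_sum_right kernel_mem sum_mem scale_mem DH ip_scale_right reproducing mult.commute)
    also have "\<bar>\<dots>\<bar> \<le> nrm f * nrm (feature h)"
      by (rule ip_Cauchy_Schwarz[OF f feature_in_rkhs(1)[OF h h_bound T]])
    also have "\<dots> \<le> nrm f * ((T - sum w F) * ?W)"
      by (intro mult_left_mono feature_in_rkhs(2)[OF h h_bound T] nrm_nonneg f)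
    finally show ?thesis by (simp add: mult_ac)
  qed
  have "((\<lambda>F. \<Sum>m\<in>F. ip f (feature (D m)) * p m) \<longlongrightarrow> f x) (finite_subsets_at_top UNIV)"
  proof (rule LIM_zero_cancel, rule Lim_null_comparison)
    have "((\<lambda>F. (nrm f * ?W) * (T - sum w F)) \<longlongrightarrow> (nrm f * ?W) * (T - T)) (finite_subsets_at_top UNIV)"
      using w unfolding has_sum_def by (intro tendsto_intros)
    then show "((\<lambda>F. (nrm f * ?W) * (T - sum w F)) \<longlongrightarrow> 0) (finite_subsets_at_top UNIV)" by simp
    show "\<forall>\<^sub>F F in finite_subsets_at_top UNIV.
        norm ((\<Sum>m\<in>F. ip f (feature (D m)) * p m) - f x) \<le> (nrm f * ?W) * (T - sum w F)"
      by (rule eventually_finite_subsets_at_top_weakI) (use error in \<open>simp add: abs_minus_commute\<close>)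
  qed
  then show ?thesis
    unfolding has_sum_def D_def[abs_def] p_def t_def by simp
qed

end

theorem theorem2p2:
  fixes \<Phi> :: "real ^ 'n \<Rightarrow> real"
    and H :: "(real ^ 'n \<Rightarrow> real) set"
    and ip :: "(real ^ 'n \<Rightarrow> real) \<Rightarrow> (real ^ 'n \<Rightarrow> real) \<Rightarrow> real"
    and \<alpha> :: real
  assumes "continuous_on UNIV \<Phi>"
    and "integrable lborel \<Phi>"
    and "positive_definite \<Phi>"
    and "rkhs (\<lambda>x y. \<Phi> (x - y)) H ip"
    and "\<alpha> > 0"
    and "spectral_decay \<Phi> \<alpha>"
  shows "(\<forall>f\<in>H. real_analytic f) \<and>
         {f \<in> H. \<exists>U. open U \<and> U \<noteq> {} \<and> (\<forall>x\<in>U. f x = 0)} = {\<lambda>x. 0}"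
proof -
  interpret rkhs "\<lambda>x y. \<Phi> (x - y)" H ip by fact
  let ?k = "(2 * pi) powr (- real CARD('n) / 2)"
  obtain C where C: "\<And>\<xi>. Re (fourier \<Phi> \<xi>) \<le> C * exp (- \<alpha> * norm \<xi>)"
    using assms(6) unfolding spectral_decay_def by blast
  have "cosine_transform \<Phi> \<xi> \<le> C / ?k * exp (- \<alpha> * norm \<xi>)" for \<xi>
    using C[of \<xi>] by (simp add: Re_fourier[OF assms(2)] field_simps)
  then obtain M where M: "finite_measure M" "sets M = sets borel"
      "\<And>b. b < \<alpha> \<Longrightarrow> integrable M (\<lambda>\<xi>. exp (b * norm \<xi>))"
      "\<And>x. \<Phi> x = (LINT \<xi>|M. cos (x \<bullet> \<xi>))"
    using spectral_measure_exists[OF assms(1,2,3,5)] by metis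
  \<comment> \<open>Squaring the weight doubles the rate, and the sum of absolute coordinates is at
    most \<open>CARD('n)\<close> times the norm. The rate becomes \<open>\<alpha> / 2\<close>,
    strictly below \<open>\<alpha>\<close> as the exponential moments require.\<close>
  define s where "s = \<alpha> / (4 * real CARD('n))"
  have s: "0 < s" using assms(5) by (simp add: s_def)
  interpret spectral_rkhs \<Phi> H ip M s
  proof (intro spectral_rkhs.intro spectral_rkhs_axioms.intro)
    have [measurable_cong]: "sets M = sets borel" by (rule M(2))
    show "integrable M (\<lambda>\<xi>. (exp (s * (\<Sum>k\<in>UNIV. \<bar>\<xi> $ k\<bar>)))\<^sup>2)"
    proof (rule Bochner_Integration.integrable_bound)
      show "integrable M (\<lambda>\<xi>. exp (\<alpha> / 2 * norm \<xi>))" using assms(5) by (intro M(3)) simp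
      show "AE \<xi> in M. norm ((exp (s * (\<Sum>k\<in>UNIV. \<bar>\<xi> $ k\<bar>)))\<^sup>2) \<le> norm (exp (\<alpha> / 2 * norm \<xi>))"
      proof (rule AE_I2)
        fix \<xi> :: "real ^ 'n"
        have "(\<Sum>k\<in>UNIV. \<bar>\<xi> $ k\<bar>) \<le> (\<Sum>k\<in>(UNIV :: 'n set). norm \<xi>)"
          by (intro sum_mono component_le_norm_cart)
        then have "2 * (s * (\<Sum>k\<in>UNIV. \<bar>\<xi> $ k\<bar>)) \<le> 2 * (s * (real CARD('n) * norm \<xi>))"
          using s by (intro mult_left_mono) auto
        also have "\<dots> = \<alpha> / 2 * norm \<xi>" by (simp add: s_def)
        finally show "norm ((exp (s * (\<Sum>k\<in>UNIV. \<bar>\<xi> $ k\<bar>)))\<^sup>2) \<le> norm (exp (\<alpha> / 2 * norm \<xi>))"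
          by (simp add: exp_double[symmetric])
      qed
    qed measurable
  qed (use assms M s in auto)
  have expansion: "\<exists>a. \<forall>x\<in>ball x0 (s / 2).
      ((\<lambda>m. a m * (\<Prod>i\<in>UNIV. (x $ i - x0 $ i) ^ m i)) has_sum f x) UNIV" if "f \<in> H" for f x0
    using power_series_expansion[OF that, where ?x0.0 = x0] by (intro exI ballI)
  have "real_analytic f" if "f \<in> H" for f
    unfolding real_analytic_def using expansion[OF that] s by (meson half_gt_zero)
  moreover have "f = (\<lambda>x. 0)" if "f \<in> H" "open U" "U \<noteq> {}" "\<forall>x\<in>U. f x = 0" for f U
    using uniformly_analytic_zero[OF _ expansion[OF that(1)] that(2,3)] that(4) s by fastforce
  \<comment> \<open>For the reverse inclusion the zero function is in \<open>H\<close> and vanishes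
    on the whole space.\<close>
  ultimately show ?thesis
    using zero_mem by (auto intro!: exI[of _ UNIV])
qed

end
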